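(* Let $X\subset\mathbb{R}^n$ and $U\subset\mathbb{R}^m$ be nonempty and open, and consider the control-affine system $$\dot x = f(x)+g(x)u,\qquad x\in X,\ u\in U,$$ with $f:X\to\mathbb{R}^n$ and $g=[g_1,\dots,g_m]$, $g_i:X\to\mathbb{R}^n$, sufficiently smooth and $g_1,\dots,g_m$ everywhere linearly independent. Suppose the system is dynamic feedback linearizable: there are open neighborhoods $O_{x_0}\subset X$ of some $x_0\in X$ and $O_{w_0}\subset\mathbb{R}^q$ of some $w_0\in\mathbb{R}^q$, and a dynamic compensator $$\dot w=\gamma(x,w)+\delta(x,w)\mu,\qquad u=\alpha(x,w)+\beta(x,w)\mu,\qquad \mu\in\mathbb{R}^m,$$ with $\alpha,\beta,\gamma,\delta$ sufficiently smooth on $O_{x_0}\times O_{w_0}$, such that the extended system $$\dot x = f(x)+g(x)\big(\alpha(x,w)+\beta(x,w)\mu\big),\qquad \dot w=\gamma(x,w)+\delta(x,w)\mu,$$ written compactly as $\dot\xi=F(\xi)+G(\xi)\mu$ with $\xi=(x,w)\in M:=O_{x_0}\times O_{w_0}$, is transformed into a linear system $$\dot z = Az+Bv,\qquad A\in\mathbb{R}^{(n+q)\times(n+q)},\ B\in\mathbb{R}^{(n+q)\times m},$$ by a diffeomorphism onto its image $z=\Phi(\xi)$, $\Phi:M\to N:=\Phi(M)\subset\mathbb{R}^{n+q}$, and a static feedback $\mu=\hat\alpha(\xi)+\hat\beta(\xi)v$, $v\in\mathbb{R}^m$, with $\hat\beta(\xi)\in\mathbb{R}^{m\times m}$ nonsingular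 for all $\xi\in M$. Let $\mathcal{D}_\Phi$ be a discretization map on $N$ such that the discretization it induces on $\dot z=Az+Bv$, namely $$\mathcal{D}_\Phi^{-1}(z_k,z_{k+1})=h\,\mathcal{L}_{v_k}\Big(\pi_N\big(\mathcal{D}_\Phi^{-1}(z_k,z_{k+1})\big)\Big),\qquad \mathcal{L}_v(z):=(z,Az+Bv)\in TN,$$ is of the form $z_{k+1}=A_hz_k+B_hv_k$ with fixed matrices $A_h\in\mathbb{R}^{(n+q)\times(n+q)}$, $B_h\in\mathbb{R}^{(n+q)\times m}$. Then $$\mathcal{D}:=(\Phi^{-1}\times\Phi^{-1})\circ\mathcal{D}_\Phi\circ T\Phi$$ is a discretization map on $M$, and it induces the first-order discretization scheme $$\mathcal{D}^{-1}(\xi_k,\xi_{k+1})=h\,\mathcal{F}_{\mu_k}\Big(\pi_M\big(\mathcal{D}^{-1}(\xi_k,\xi_{k+1})\big)\Big),\qquad \mathcal{F}_\mu(\xi):=(\xi,F(\xi)+G(\xi)\mu)\in TM,$$ of the extended system, which is (static) feedback linearizable in the discrete-time sense. Moreover, the discrete linearizing feedback is given by $$\mu_k=\hat\alpha(\xi_k)+\hat\beta(\xi_k)v_k .$$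
   Context: Transformed into a linear system: the identities $A\,\Phi(\xi)=D\Phi(\xi)\cdot\big(F(\xi)+G(\xi)\hat\alpha(\xi)\big)$ and $B=D\Phi(\xi)\cdot G(\xi)\hat\beta(\xi)$ hold for all $\xi\in M$, with $A,B$ constant matrices. Discretization map: for a manifold $M$ with tangent bundle $TM$, let $\mathcal{O}\subset TM$ be an open neighborhood of the zero section. A smooth map $\mathcal{D}=(\mathcal{D}^1,\mathcal{D}^2):\mathcal{O}\to M\times M$ is a discretization map on $M$ if for every $x\in M$: (1) $\mathcal{D}(x,0_x)=(x,x)$, where $0_x$ is the zero vector of $T_xM$; (2) $T_{(x,0_x)}\mathcal{D}^2-T_{(x,0_x)}\mathcal{D}^1: T_{(x,0_x)}T_xM\simeq T_xM\to T_xM$ is the identity map of $T_xM$, where $T_{(x,0_x)}\mathcal{D}^i$ is the tangent map at $(x,0_x)$ (restricted to the vertical space $T_{(x,0_x)}T_xM$, canonically identified with $T_xM$). $\mathcal{D}^{-1}$ denotes the (local) inverse of $\mathcal{D}$ near the zero section. Notation: $\pi_M:TM\to M$, $\pi_M(x,\dot x)=x$, is the canonical projection (similarly $\pi_N$); $T\Phi:TM\to TN$, $T\Phi(\xi,\dot\xi)=(\Phi(\xi),D\Phi(\xi)\dot\xi)$, is the tangent map of $\Phi$. For $h>0$, $h\mathcal{F}_\mu(\xi):=(\xi,h(F(\xi)+G(\xi)\mu))$ and $h\mathcal{L}_v(z):=(z,h(Az+Bv))$. Here $h>0$ is the step size, $t_{k+1}=t_k+h$, $k\in\mathbb{N}$,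 $\xi_k$ approximates $\xi(t_k)$, and the control is held constant equal to $\mu_k$ on $[t_k,t_{k+1})$. The scheme for $\xi$ is implicit: it is understood as solved locally for $\xi_{k+1}$, giving a discrete-time system $\xi_{k+1}=\bar F_h(\xi_k,\mu_k)$ (local existence by the implicit function theorem). Order of a scheme: a numerical approximation $\xi_{k+1}=\bar F_h(\xi_k,\mu_k)$ of a continuous-time system is of order $r$ if there exist $K>0$ and $h_0>0$ such that for all $0<h<h_0$, $\|\xi(t_{k+1})-\bar F_h(\xi(t_k),\mu_k)\|/h\le Kh^r$, where $t\mapsto\xi(t)$ is a solution of the continuous-time system; first-order means $r=1$. Discrete-time static feedback linearizability: a discrete-time system $\xi_{k+1}=\bar F_h(\xi_k,\mu_k)$ is (static) feedback linearizable if there are a change of coordinates $z=\phi(\xi)$ ($\phi$ a diffeomorphism onto its image) and a feedback $\mu_k=\psi(\xi_k,v_k)$, invertible with respect to $v_k$ (the linearizing feedback), that transform it into a linear discrete-time system $z_{k+1}=\tilde A z_k+\tilde B v_k$ with constant matrices $\tilde A,\tilde B$.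
   Formalization: The "Moreover" formula at ξ_k fails in general (e.g. midpoint map); proved instead: μ_k = α̂(p)+β̂(p)v_k with p = π_M(D^{-1}(ξ_k,ξ_{k+1})), which is the printed formula when the first component of D_Φ is the projection (z,ż)↦z. *)

theory Defs
  imports "HOL-Analysis.Analysis"
begin

text \<open>Intended for open \<open>S\<close> only: \<open>C\<^sup>k\<close> maps, through iterated directional derivatives.\<close>

primrec Ck_on :: "nat \<Rightarrow> 'a::real_normed_vector set \<Rightarrow> ('a \<Rightarrow> 'b::real_normed_vector) \<Rightarrow> bool" where
  "Ck_on 0 S f \<longleftrightarrow> continuous_on S f"
| "Ck_on (Suc k) S f \<longleftrightarrow>
     (\<forall>x\<in>S. f differentiable (at x)) \<and> (\<forall>v. Ck_on k S (\<lambda>x. frechet_derivative f (at x) v))"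

definition smooth_on :: "'a::real_normed_vector set \<Rightarrow> ('a \<Rightarrow> 'b::real_normed_vector) \<Rightarrow> bool" where
  "smooth_on S f \<longleftrightarrow> (\<forall>k. Ck_on k S f)"

definition diffeo_onto_image :: "'a::real_normed_vector set \<Rightarrow> ('a \<Rightarrow> 'b::real_normed_vector) \<Rightarrow> bool" where
  "diffeo_onto_image S f \<longleftrightarrow>
     open S \<and> smooth_on S f \<and> inj_on f S \<and> open (f ` S) \<and> smooth_on (f ` S) (inv_into S f)"


section \<open>Discretization maps on open subsets of Euclidean space\<close>

text \<open>All manifolds here are open subsets \<open>M\<close> of a Euclidean space, with \<open>TM = M \<times> UNIV\<close>; the
  canonical projection \<open>TM \<rightarrow> M\<close> is \<^const>\<open>fst\<close>.  The set \<open>T\<close> is the domain of the map,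
  an open neighbourhood of the zero section.  The last clause takes the derivative along the fibre
  over \<open>x\<close>, at the zero vector.\<close>

definition discretization_map ::
  "'a::euclidean_space set \<Rightarrow> ('a \<times> 'a) set \<Rightarrow> ('a \<times> 'a \<Rightarrow> 'a \<times> 'a) \<Rightarrow> bool" where
  "discretization_map M T D \<longleftrightarrow>
     open M \<and> open T \<and> T \<subseteq> M \<times> UNIV \<and> (\<forall>x\<in>M. (x, 0) \<in> T) \<and>
     smooth_on T D \<and> D ` T \<subseteq> M \<times> M \<and>
     (\<forall>x\<in>M. D (x, 0) = (x, x)) \<and>
     (\<forall>x\<in>M. \<forall>v. frechet_derivative (\<lambda>y. snd (D (x, y))) (at 0) v
                 - frechet_derivative (\<lambda>y. fst (D (x, y))) (at 0) v = v)"

text \<open>A choice of the local inverse of \<open>D\<close> near the zero section: \<open>W\<close> is a neighbourhood of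
  the zero section which \<open>D\<close> maps diffeomorphically onto its image, and the inverse is
  \<^term>\<open>inv_into W D\<close>, defined on \<open>D ` W\<close>.\<close>

definition local_inverse_domain ::
  "'a::euclidean_space set \<Rightarrow> ('a \<times> 'a) set \<Rightarrow> ('a \<times> 'a \<Rightarrow> 'a \<times> 'a) \<Rightarrow> ('a \<times> 'a) set \<Rightarrow> bool" where
  "local_inverse_domain M T D W \<longleftrightarrow>
     W \<subseteq> T \<and> (\<forall>x\<in>M. (x, 0) \<in> W) \<and> diffeo_onto_image W D"

text \<open>One step \<open>x \<mapsto> y\<close> of the implicit scheme induced on \<open>x' = V x u\<close> with step size \<open>h\<close>
  and control value \<open>u\<close>.\<close>

definition induced_step ::
  "('a::euclidean_space \<times> 'a \<Rightarrow> 'a \<times> 'a) \<Rightarrow> ('a \<times> 'a) set \<Rightarrow> ('a \<Rightarrow> 'u \<Rightarrow> 'a) \<Rightarrow>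
   real \<Rightarrow> 'a \<Rightarrow> 'u \<Rightarrow> 'a \<Rightarrow> bool" where
  "induced_step D W V h x u y \<longleftrightarrow>
     (x, y) \<in> D ` W \<and>
     (let p = fst (inv_into W D (x, y)) in inv_into W D (x, y) = (p, h *\<^sub>R V p u))"

text \<open>\<open>Fb h\<close> is the explicit discrete-time system obtained by solving the implicit relation
  \<open>R h x u y\<close> for \<open>y\<close> near \<open>x\<close>.  As the implicit function theorem only provides solutions for
  steps that are small locally uniformly in state and control, \<open>Fb h\<close> lives on an open set
  \<open>E h\<close> of pairs (state, control), and these sets swallow every compact set as \<open>h\<close> tends
  to \<open>0\<close>.\<close>

definition locally_solved ::
  "'a::euclidean_space set \<Rightarrow> (real \<Rightarrow> 'a \<Rightarrow> 'u::euclidean_space \<Rightarrow> 'a \<Rightarrow> bool) \<Rightarrow>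
   (real \<Rightarrow> ('a \<times> 'u) set) \<Rightarrow> (real \<Rightarrow> 'a \<Rightarrow> 'u \<Rightarrow> 'a) \<Rightarrow> bool" where
  "locally_solved M R E Fb \<longleftrightarrow>
     (\<forall>h>0. open (E h) \<and> E h \<subseteq> M \<times> UNIV \<and> (\<forall>(x, u)\<in>E h. R h x u (Fb h x u))) \<and>
     (\<forall>C. compact C \<and> C \<subseteq> M \<times> UNIV \<longrightarrow>
        (\<exists>h0>0. \<exists>\<epsilon>>0. \<forall>h. 0 < h \<and> h < h0 \<longrightarrow>
           C \<subseteq> E h \<and>
           (\<forall>(x, u)\<in>C. dist (Fb h x u) x < \<epsilon> \<and>
              (\<forall>y. dist y x < \<epsilon> \<and> R h x u y \<longrightarrow> y = Fb h x u))))"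

text \<open>Local truncation error of order \<open>r\<close>, for a control held constant over the step; the
  constants are uniform for initial state and control in a compact set.\<close>

definition scheme_of_order ::
  "nat \<Rightarrow> 'a::euclidean_space set \<Rightarrow> ('a \<Rightarrow> 'u::euclidean_space \<Rightarrow> 'a) \<Rightarrow>
   (real \<Rightarrow> 'a \<Rightarrow> 'u \<Rightarrow> 'a) \<Rightarrow> bool" where
  "scheme_of_order r M V Fb \<longleftrightarrow>
     (\<forall>C. compact C \<and> C \<subseteq> M \<times> UNIV \<longrightarrow>
        (\<exists>K>0. \<exists>h0>0. \<forall>h t u \<xi>.
           0 < h \<and> h < h0 \<and> (\<xi> t, u) \<in> C \<and>
           (\<forall>s\<in>{t..t+h}. \<xi> s \<in> M \<and>
              (\<xi> has_vector_derivative V (\<xi> s) u) (at s within {t..t+h})) \<longrightarrow>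
           norm (\<xi> (t + h) - Fb h (\<xi> t) u) / h \<le> K * h ^ r))"


section \<open>Feedback linearization\<close>

text \<open>Continuous time, for \<open>x' = F x + G x u\<close> with \<open>G x\<close> linear.\<close>

definition transformed_into_linear ::
  "'a::euclidean_space set \<Rightarrow> ('a \<Rightarrow> 'a) \<Rightarrow> ('a \<Rightarrow> real^'m \<Rightarrow> 'a) \<Rightarrow> ('a \<Rightarrow> real^'d) \<Rightarrow>
   ('a \<Rightarrow> real^'m) \<Rightarrow> ('a \<Rightarrow> real^'m^'m) \<Rightarrow> real^'d^'d \<Rightarrow> real^'m^'d \<Rightarrow> bool" where
  "transformed_into_linear M F G \<Phi> a b A B \<longleftrightarrow>
     diffeo_onto_image M \<Phi> \<and> Ck_on 1 M a \<and> Ck_on 1 M b \<and>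
     (\<forall>\<xi>\<in>M. invertible (b \<xi>)) \<and>
     (\<forall>\<xi>\<in>M. A *v \<Phi> \<xi> = frechet_derivative \<Phi> (at \<xi>) (F \<xi> + G \<xi> (a \<xi>))) \<and>
     (\<forall>\<xi>\<in>M. \<forall>v. B *v v = frechet_derivative \<Phi> (at \<xi>) (G \<xi> (b \<xi> *v v)))"

text \<open>Discrete time, for a system \<open>x\<^sup>+ = Fh x u\<close> whose right-hand side is defined for \<open>(x, u)\<close>
  in the open set \<open>E\<close>.  Invertibility of the feedback \<open>u = \<psi> x v\<close> with respect to \<open>v\<close> means
  that \<open>v = \<kappa> x u\<close> for some \<open>\<kappa>\<close>.\<close>

definition discrete_linearized_by ::
  "'a::euclidean_space set \<Rightarrow> ('a \<times> (real^'m)) set \<Rightarrow> ('a \<Rightarrow> real^'m \<Rightarrow> 'a) \<Rightarrow>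
   ('a \<Rightarrow> real^'d) \<Rightarrow> ('a \<times> (real^'m)) set \<Rightarrow> ('a \<Rightarrow> real^'m \<Rightarrow> real^'m) \<Rightarrow>
   real^'d^'d \<Rightarrow> real^'m^'d \<Rightarrow> bool" where
  "discrete_linearized_by M E Fh \<phi> E' \<psi> A B \<longleftrightarrow>
     diffeo_onto_image M \<phi> \<and> open E' \<and> E' \<subseteq> M \<times> UNIV \<and>
     (\<exists>\<kappa>. homeomorphism E' E (\<lambda>(x, v). (x, \<psi> x v)) (\<lambda>(x, u). (x, \<kappa> x u))) \<and>
     (\<forall>(x, v)\<in>E'. \<phi> (Fh x (\<psi> x v)) = A *v \<phi> x + B *v v)"

definition discrete_feedback_linearizable ::
  "((real^'n) \<times> (real^'q)) set \<Rightarrow> (((real^'n) \<times> (real^'q)) \<times> (real^'m)) set \<Rightarrow>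
   ((real^'n) \<times> (real^'q) \<Rightarrow> real^'m \<Rightarrow> (real^'n) \<times> (real^'q)) \<Rightarrow> bool" where
  "discrete_feedback_linearizable M E Fh \<longleftrightarrow>
     (\<exists>(\<phi> :: (real^'n) \<times> (real^'q) \<Rightarrow> real^('n + 'q)) E' \<psi> A B.
        discrete_linearized_by M E Fh \<phi> E' \<psi> A B)"


section \<open>The extended system and the transported discretization map\<close>

definition extended_drift ::
  "('x \<Rightarrow> 'x::real_vector) \<Rightarrow> ('x \<Rightarrow> 'm \<Rightarrow> 'x) \<Rightarrow> ('x \<times> 'w \<Rightarrow> 'm) \<Rightarrow> ('x \<times> 'w \<Rightarrow> 'w::real_vector) \<Rightarrow>
   'x \<times> 'w \<Rightarrow> 'x \<times> 'w" where
  "extended_drift f g \<alpha> \<gamma> \<xi> = (f (fst \<xi>) + g (fst \<xi>) (\<alpha> \<xi>), \<gamma> \<xi>)"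

definition extended_input ::
  "('x \<Rightarrow> 'm \<Rightarrow> 'x) \<Rightarrow> ('x \<times> 'w \<Rightarrow> 'm \<Rightarrow> 'm) \<Rightarrow> ('x \<times> 'w \<Rightarrow> 'm \<Rightarrow> 'w) \<Rightarrow>
   'x \<times> 'w \<Rightarrow> 'm \<Rightarrow> 'x \<times> 'w" where
  "extended_input g \<beta> \<delta> \<xi> \<mu> = (g (fst \<xi>) (\<beta> \<xi> \<mu>), \<delta> \<xi> \<mu>)"

definition tangent_map ::
  "('a::real_normed_vector \<Rightarrow> 'b::real_normed_vector) \<Rightarrow> 'a \<times> 'a \<Rightarrow> 'b \<times> 'b" where
  "tangent_map \<Phi> = (\<lambda>(\<xi>, v). (\<Phi> \<xi>, frechet_derivative \<Phi> (at \<xi>) v))"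

definition transported_map ::
  "'a::real_normed_vector set \<Rightarrow> ('a \<Rightarrow> 'b::real_normed_vector) \<Rightarrow> ('b \<times> 'b \<Rightarrow> 'b \<times> 'b) \<Rightarrow>
   'a \<times> 'a \<Rightarrow> 'a \<times> 'a" where
  "transported_map M \<Phi> D\<^sub>\<Phi> = map_prod (inv_into M \<Phi>) (inv_into M \<Phi>) \<circ> D\<^sub>\<Phi> \<circ> tangent_map \<Phi>"

definition transported_domain ::
  "'a::real_normed_vector set \<Rightarrow> ('a \<Rightarrow> 'b::real_normed_vector) \<Rightarrow> ('b \<times> 'b) set \<Rightarrow> ('a \<times> 'a) set" where
  "transported_domain M \<Phi> T = {\<zeta> \<in> M \<times> UNIV. tangent_map \<Phi> \<zeta> \<in> T}"

end

theory Submission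
  imports Defs
begin

text \<open>The tangent map of \<open>\<Phi>\<close> conjugates the transported discretization with the given one, and on
  tangent vectors \<open>h (F p + G p \<mu>)\<close> with \<open>\<mu> = ahat p + bhat p v\<close> it takes the value \<open>h (A z + B v)\<close>
  at \<open>z = \<Phi> p\<close>.  Hence \<open>\<Phi>\<close> maps a step of the transported scheme to a step of the scheme for the
  linear system; the feedback is evaluated at the node \<open>p\<close>, which is the initial state if the first
  component of the discretization map is the projection.

  With \<open>w = h V(p, u)\<close> the scheme reads \<open>x = D\<^sup>1(p, w)\<close>, \<open>y = D\<^sup>2(p, w)\<close>.  On compact sets
  \<open>D\<^sup>1(p, w) - p = O(h)\<close>, with Lipschitz constant \<open>O(h)\<close> in \<open>p\<close>, and \<open>D\<^sup>2 - D\<^sup>1 - w = O(h\<^sup>2)\<close>.  The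
  first estimate gives solvability by Brouwer's theorem and uniqueness for small \<open>h\<close>, and together they
  give a local error \<open>O(h\<^sup>2)\<close>.  The change of variables from \<open>(x, v)\<close> to
  \<open>(x, u)\<close> passes through the nodes and is a homeomorphism by invariance of domain.\<close>

section \<open>Calculus of \<open>C\<^sup>k\<close> maps\<close>

text \<open>How small \<open>h\<close> must be depends on the compact set under consideration, so
  the estimates do not provide one bound for the whole state space. The set
  \<open>\<Omega> h\<close> of admissible nodes is therefore assembled, for each \<open>h\<close>,
  from a compact exhaustion. The linearization, however, is claimed for every \<open>h\<close> below
  \<open>hbar\<close>, where the estimates need not apply. Two facts replace smallness there:
  \<open>base h\<close> is injective on \<open>\<Omega> h\<close> by construction, and the node can
  be recovered from \<open>(x, v)\<close> because the linear form of the step fixes its end point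
  while \<open>D\<close> is injective on \<open>W\<close>. The orders in \<open>h\<close> come from
  the zero section. The identity D(p, 0) = (p, p) holds for all p, so it may be differentiated in p;
  together with the normalization of the fibre derivatives this makes the relevant errors vanish
  there to first or second order. Only \<open>D\<close> is differentiated twice; the vector field
  enters with a bound and a Lipschitz constant. The topological theorems ask for continuity alone,
  which suits a feedback that is composed from inverses of continuous injections.\<close>

lemma Ck_on_cong:
  assumes "open S" "\<And>x. x \<in> S \<Longrightarrow> f x = g x"
  shows "Ck_on k S f \<longleftrightarrow> Ck_on k S g"
  using assms(2)
proof (induction k arbitrary: f g)
  case 0
  then show ?case by (simp cong: continuous_on_cong)
next
  case (Suc k)
  have D: "(f has_derivative f') (at x) \<longleftrightarrow> (g has_derivative f') (at x)" if "x \<in> S" for x f'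
    using has_derivative_transform_within_open[OF _ assms(1) that, of f f' UNIV g]
      has_derivative_transform_within_open[OF _ assms(1) that, of g f' UNIV f] Suc.prems by auto
  have "frechet_derivative f (at x) = frechet_derivative g (at x)" if "x \<in> S" for x
    unfolding frechet_derivative_def D[OF that] ..
  then have "Ck_on k S (\<lambda>x. frechet_derivative f (at x) v) \<longleftrightarrow>
      Ck_on k S (\<lambda>x. frechet_derivative g (at x) v)" for v
    by (intro Suc.IH) simp
  moreover have "f differentiable (at x) \<longleftrightarrow> g differentiable (at x)" if "x \<in> S" for x
    unfolding differentiable_def D[OF that] ..
  ultimately show ?case by simp
qed

lemma Ck_on_continuous: "Ck_on k S f \<Longrightarrow> continuous_on S f"
  by (cases k) (auto intro!: continuous_at_imp_continuous_on differentiable_imp_continuous_within)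

lemma Ck_on_SucD: "Ck_on (Suc k) S f \<Longrightarrow> Ck_on k S f"
proof (induction k arbitrary: f)
  case 0
  then show ?case using Ck_on_continuous[of "Suc 0" S f] by simp
next
  case (Suc k)
  then show ?case
    unfolding Ck_on.simps(2)[of "Suc k" S f] Ck_on.simps(2)[of k S f] by blast
qed

lemma Ck_on_subset: "Ck_on k S f \<Longrightarrow> T \<subseteq> S \<Longrightarrow> Ck_on k T f"
  by (induction k arbitrary: f) (auto intro: continuous_on_subset)

text \<open>Any derivative known in closed form may stand in for \<open>frechet_derivative\<close>.
  The inductions below use this to present the derivative as an expression in maps to which the
  induction hypothesis applies.\<close>

lemma Ck_on_SucI:
  assumes "open S" "\<And>x. x \<in> S \<Longrightarrow> (f has_derivative f' x) (at x)"
    and "\<And>v. Ck_on k S (\<lambda>x. f' x v)"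
  shows "Ck_on (Suc k) S f"
proof -
  have "Ck_on k S (\<lambda>x. frechet_derivative f (at x) v)" for v
    using Ck_on_cong[OF assms(1), of "\<lambda>x. frechet_derivative f (at x) v" "\<lambda>x. f' x v" k]
      frechet_derivative_at[OF assms(2)] assms(3) by force
  then show ?thesis using assms(2) by (auto simp: differentiable_def)
qed

lemma Ck_on_has_derivative:
  "Ck_on (Suc k) S f \<Longrightarrow> x \<in> S \<Longrightarrow> (f has_derivative frechet_derivative f (at x)) (at x)"
  by (simp add: frechet_derivative_works)

lemma Ck_on_const: "Ck_on k S (\<lambda>x. c)"
proof (induction k arbitrary: c)
  case (Suc k)
  have "frechet_derivative (\<lambda>x. c) (at x) = (\<lambda>_. 0)" for x :: 'a
    by simp
  then show ?case using Suc by simp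
qed simp

section \<open>Closure under linear maps, sums, products and composition\<close>

lemma Ck_on_linear:
  assumes "bounded_linear L" "open S" "Ck_on k S f"
  shows "Ck_on k S (\<lambda>x. L (f x))"
  using assms(3)
proof (induction k arbitrary: f)
  case 0
  then show ?case by (simp add: bounded_linear.continuous_on[OF assms(1)])
next
  case (Suc k)
  show ?case
  proof (rule Ck_on_SucI[OF assms(2)])
    show "((\<lambda>x. L (f x)) has_derivative (\<lambda>v. L (frechet_derivative f (at x) v))) (at x)"
      if "x \<in> S" for x
      by (rule bounded_linear.has_derivative[OF assms(1) Ck_on_has_derivative[OF Suc.prems that]])
    show "Ck_on k S (\<lambda>x. L (frechet_derivative f (at x) v))" for v
      using Suc by simp
  qed
qed

lemma Ck_on_id: "open S \<Longrightarrow> Ck_on k S (\<lambda>x. x)"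
  by (cases k) (auto intro: Ck_on_SucI has_derivative_ident Ck_on_const)

lemma Ck_on_bounded_linear: "bounded_linear L \<Longrightarrow> open S \<Longrightarrow> Ck_on k S L"
  using Ck_on_linear Ck_on_id by blast

lemma Ck_on_add:
  assumes "open S" "Ck_on k S f" "Ck_on k S g"
  shows "Ck_on k S (\<lambda>x. f x + g x)"
  using assms(2,3)
proof (induction k arbitrary: f g)
  case (Suc k)
  show ?case
    by (rule Ck_on_SucI[OF assms(1) has_derivative_add[OF Ck_on_has_derivative[OF Suc.prems(1)]
            Ck_on_has_derivative[OF Suc.prems(2)]]]) (use Suc in auto)
qed (simp add: continuous_on_add)

lemma Ck_on_sum:
  assumes "open S" "\<And>i. i \<in> I \<Longrightarrow> Ck_on k S (f i)"
  shows "Ck_on k S (\<lambda>x. \<Sum>i\<in>I. f i x)"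
  using assms(2)
proof (induction I rule: infinite_finite_induct)
  case (insert i I)
  have "Ck_on k S (\<lambda>x. f i x + (\<Sum>i\<in>I. f i x))"
    by (rule Ck_on_add[OF assms(1)]) (use insert in blast)+
  then show ?case using insert.hyps by simp
qed (simp_all add: Ck_on_const)

text \<open>The product rule pairs each derivative with the other, undifferentiated factor. Lowering
  that factor by one class lets the induction hypothesis treat both summands.\<close>

lemma Ck_on_bilinear:
  assumes "bounded_bilinear pr" "open S" "Ck_on k S f" "Ck_on k S g"
  shows "Ck_on k S (\<lambda>x. pr (f x) (g x))"
  using assms(3,4)
proof (induction k arbitrary: f g)
  case 0
  then show ?case by (simp add: bounded_bilinear.continuous_on[OF assms(1)])
next
  case (Suc k)
  note S = Suc.prems[THEN Ck_on_SucD]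
  show ?case
  proof (rule Ck_on_SucI[OF assms(2) bounded_bilinear.FDERIV[OF assms(1)
        Ck_on_has_derivative[OF Suc.prems(1)] Ck_on_has_derivative[OF Suc.prems(2)]]])
    show "Ck_on k S (\<lambda>x. pr (f x) (frechet_derivative g (at x) v)
        + pr (frechet_derivative f (at x) v) (g x))" for v
      using Suc S by (intro Ck_on_add[OF assms(2)] Suc.IH) auto
  qed
qed

text \<open>\<open>Ck_on\<close> controls derivatives in fixed directions only. Expanding in the
  basis trades a direction that varies with the point for finitely many fixed ones with scalar
  coefficients, as the chain rule and the tangent map require.\<close>

lemma euclidean_linear_expansion:
  fixes L :: "'a::euclidean_space \<Rightarrow> 'b::real_vector"
  assumes "linear L"
  shows "L v = (\<Sum>b\<in>Basis. (v \<bullet> b) *\<^sub>R L b)"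
proof -
  have "L v = L (\<Sum>b\<in>Basis. (v \<bullet> b) *\<^sub>R b)" by (simp only: euclidean_representation)
  also have "\<dots> = (\<Sum>b\<in>Basis. (v \<bullet> b) *\<^sub>R L b)"
    by (simp add: linear_sum[OF assms] linear_scale[OF assms])
  finally show ?thesis .
qed

text \<open>In basis coordinates the derivative is a sum of scalar functions times directional
  derivatives of \<open>g\<close> composed with \<open>f\<close>. These are again compositions with
  inner map \<open>f\<close>, hence the induction over a varying \<open>g\<close>.\<close>

lemma Ck_on_compose:
  fixes f :: "'a::real_normed_vector \<Rightarrow> 'b::euclidean_space"
  assumes "open S" "open T" "f ` S \<subseteq> T" "Ck_on k S f" "Ck_on k T g"
  shows "Ck_on k S (\<lambda>x. g (f x))"
  using assms(4,5)
proof (induction k arbitrary: g)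
  case 0
  then show ?case using assms(3) by (auto intro: continuous_on_compose2)
next
  case (Suc k)
  let ?f' = "\<lambda>x. frechet_derivative f (at x)" and ?g' = "\<lambda>x. frechet_derivative g (at x)"
  have d: "(g has_derivative ?g' (f x)) (at (f x))" if "x \<in> S" for x
    using Suc.prems(2) assms(3) that by (intro Ck_on_has_derivative) auto
  show ?case
  proof (rule Ck_on_SucI[OF assms(1)])
    show "((\<lambda>x. g (f x)) has_derivative (\<lambda>v. \<Sum>b\<in>Basis. (?f' x v \<bullet> b) *\<^sub>R ?g' (f x) b)) (at x)"
      if "x \<in> S" for x
    proof -
      have "(\<lambda>v. \<Sum>b\<in>Basis. (?f' x v \<bullet> b) *\<^sub>R ?g' (f x) b) = (\<lambda>v. ?g' (f x) (?f' x v))"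
        by (rule ext) (rule euclidean_linear_expansion[OF has_derivative_linear[OF d[OF that]], symmetric])
      then show ?thesis
        using has_derivative_compose[OF Ck_on_has_derivative[OF Suc.prems(1) that] d[OF that]] by argo
    qed
    show "Ck_on k S (\<lambda>x. \<Sum>b\<in>Basis. (?f' x v \<bullet> b) *\<^sub>R ?g' (f x) b)" for v
    proof (intro Ck_on_sum Ck_on_bilinear[OF bounded_bilinear_scaleR] assms(1))
      show "Ck_on k S (\<lambda>x. ?f' x v \<bullet> b)" for b
        by (rule Ck_on_linear[OF bounded_linear_inner_left assms(1)]) (use Suc.prems in simp)
      show "Ck_on k S (\<lambda>x. ?g' (f x) b)" for b
        by (rule Suc.IH[OF Ck_on_SucD[OF Suc.prems(1)]]) (use Suc.prems in simp)
    qed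
  qed
qed

lemma Ck_on_Pair:
  assumes "open S" "Ck_on k S f" "Ck_on k S g"
  shows "Ck_on k S (\<lambda>x. (f x, g x))"
  using Ck_on_add[OF assms(1) Ck_on_linear[OF bounded_linear_Pair[OF bounded_linear_ident bounded_linear_zero] assms(1,2)]
      Ck_on_linear[OF bounded_linear_Pair[OF bounded_linear_zero bounded_linear_ident] assms(1,3)]]
  by simp

lemmas Ck_on_fst = Ck_on_linear[OF bounded_linear_fst]

text \<open>Joint regularity in point and direction makes tangent maps smooth, and it lets operator
  bounds be read off on a compact set times the unit sphere.\<close>

lemma Ck_on_derivative_pair:
  fixes f :: "'a::euclidean_space \<Rightarrow> 'b::real_normed_vector"
  assumes "open S" "Ck_on (Suc k) S f"
  shows "Ck_on k (S \<times> UNIV) (\<lambda>q. frechet_derivative f (at (fst q)) (snd q))"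
proof -
  have o: "open (S \<times> (UNIV::'a set))" using assms(1) by (simp add: open_Times)
  have "Ck_on k (S \<times> UNIV) (\<lambda>q. \<Sum>b\<in>Basis. (snd q \<bullet> b) *\<^sub>R frechet_derivative f (at (fst q)) b)"
  proof (intro Ck_on_sum Ck_on_bilinear[OF bounded_bilinear_scaleR] o)
    show "Ck_on k (S \<times> UNIV) (\<lambda>q. snd q \<bullet> b)" for b :: 'a
      by (rule Ck_on_linear[OF bounded_linear_inner_left o Ck_on_bounded_linear[OF bounded_linear_snd o]])
    show "Ck_on k (S \<times> (UNIV::'a set)) (\<lambda>q. frechet_derivative f (at (fst q)) b)" for b
      using assms(2) by (intro Ck_on_compose[OF o assms(1) _ Ck_on_bounded_linear[OF bounded_linear_fst o]]) auto
  qed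
  moreover have "frechet_derivative f (at (fst q)) (snd q)
      = (\<Sum>b\<in>Basis. (snd q \<bullet> b) *\<^sub>R frechet_derivative f (at (fst q)) b)" if "q \<in> S \<times> UNIV" for q
    using that assms(2)
    by (intro euclidean_linear_expansion linear_frechet_derivative) auto
  ultimately show ?thesis by (rule iffD2[OF Ck_on_cong[OF o], rotated])
qed

section \<open>Smooth maps, tangent maps and products\<close>

lemma smooth_on_cong:
  "open S \<Longrightarrow> (\<And>x. x \<in> S \<Longrightarrow> f x = g x) \<Longrightarrow> smooth_on S f \<longleftrightarrow> smooth_on S g"
  unfolding smooth_on_def using Ck_on_cong by metis

lemma smooth_on_continuous: "smooth_on S f \<Longrightarrow> continuous_on S f"
  unfolding smooth_on_def using Ck_on_continuous by blast

lemma smooth_on_subset: "smooth_on S f \<Longrightarrow> T \<subseteq> S \<Longrightarrow> smooth_on T f"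
  unfolding smooth_on_def using Ck_on_subset by blast

lemma smooth_on_has_derivative:
  "smooth_on S f \<Longrightarrow> x \<in> S \<Longrightarrow> (f has_derivative frechet_derivative f (at x)) (at x)"
  unfolding smooth_on_def using Ck_on_has_derivative by blast

lemma smooth_on_compose:
  fixes f :: "'a::real_normed_vector \<Rightarrow> 'b::euclidean_space"
  assumes "open S" "open T" "f ` S \<subseteq> T" "smooth_on S f" "smooth_on T g"
  shows "smooth_on S (\<lambda>x. g (f x))"
  using assms Ck_on_compose unfolding smooth_on_def by blast

lemma smooth_on_tangent_map:
  fixes f :: "'a::euclidean_space \<Rightarrow> 'b::real_normed_vector"
  assumes "open S" "smooth_on S f"
  shows "smooth_on (S \<times> UNIV) (tangent_map f)"
proof -
  have o: "open (S \<times> (UNIV::'a set))" using assms(1) by (simp add: open_Times)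
  have "Ck_on k (S \<times> UNIV) (\<lambda>q. (f (fst q), frechet_derivative f (at (fst q)) (snd q)))" for k
    using assms(2) unfolding smooth_on_def
    by (intro Ck_on_Pair[OF o] Ck_on_derivative_pair[OF assms(1)]
        Ck_on_compose[OF o assms(1) _ Ck_on_bounded_linear[OF bounded_linear_fst o]]) auto
  then show ?thesis by (simp add: smooth_on_def tangent_map_def case_prod_unfold)
qed

lemma smooth_on_map_prod:
  fixes f :: "'a::euclidean_space \<Rightarrow> 'b::real_normed_vector"
  assumes "open S" "smooth_on S f"
  shows "smooth_on (S \<times> S) (map_prod f f)"
proof -
  have o: "open (S \<times> S)" using assms(1) by (simp add: open_Times)
  have "Ck_on k (S \<times> S) (\<lambda>q. (f (fst q), f (snd q)))" for k
    using assms(2) unfolding smooth_on_def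
    by (intro Ck_on_Pair[OF o]
        Ck_on_compose[OF o assms(1) _ Ck_on_bounded_linear[OF bounded_linear_fst o]]
        Ck_on_compose[OF o assms(1) _ Ck_on_bounded_linear[OF bounded_linear_snd o]]) auto
  then show ?thesis by (simp add: smooth_on_def map_prod_def case_prod_unfold)
qed

section \<open>Transport along a diffeomorphism\<close>

text \<open>Differentiate \<open>g (f y) = y\<close>, valid on an open set, and use uniqueness of
  derivatives. It is applied to \<open>\<Phi>\<close> and its inverse in both orders.\<close>

lemma tangent_map_left_inverse:
  assumes "open S" "\<And>x. x \<in> S \<Longrightarrow> g (f x) = x" "q \<in> S \<times> UNIV"
    and f: "f differentiable (at (fst q))" and g: "g differentiable (at (f (fst q)))"
  shows "tangent_map g (tangent_map f q) = q"
proof -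
  obtain x v where q: "q = (x, v)" "x \<in> S" using assms(3) by auto
  have "((\<lambda>y. g (f y)) has_derivative
      (\<lambda>w. frechet_derivative g (at (f x)) (frechet_derivative f (at x) w))) (at x)"
    by (rule has_derivative_compose[OF iffD1[OF frechet_derivative_works f, unfolded q fst_conv]
          iffD1[OF frechet_derivative_works g, unfolded q fst_conv]])
  then have "((\<lambda>y. y) has_derivative
      (\<lambda>w. frechet_derivative g (at (f x)) (frechet_derivative f (at x) w))) (at x)"
    by (rule has_derivative_transform_within_open[OF _ assms(1) q(2)]) (use assms(2) in auto)
  then have "(\<lambda>w. frechet_derivative g (at (f x)) (frechet_derivative f (at x) w)) = (\<lambda>w. w)"
    using has_derivative_ident by (rule has_derivative_unique)
  then have "frechet_derivative g (at (f x)) (frechet_derivative f (at x) v) = v"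
    by (rule fun_cong)
  then show ?thesis using assms(2) q by (simp add: tangent_map_def)
qed

lemma tangent_map_zero: "f differentiable (at x) \<Longrightarrow> tangent_map f (x, 0) = (f x, 0)"
  using linear_0[OF linear_frechet_derivative] by (auto simp: tangent_map_def)

lemma transported_map_eq:
  "transported_map M \<Phi> D q = map_prod (inv_into M \<Phi>) (inv_into M \<Phi>) (D (tangent_map \<Phi> q))"
  by (simp add: transported_map_def)

context
  fixes M :: "'a::euclidean_space set" and \<Phi> :: "'a \<Rightarrow> 'b::euclidean_space"
  assumes diffeo: "diffeo_onto_image M \<Phi>"
begin

lemma diffeo_open: "open M" and diffeo_open_image: "open (\<Phi> ` M)"
    and diffeo_smooth: "smooth_on M \<Phi>" and diffeo_inv_smooth: "smooth_on (\<Phi> ` M) (inv_into M \<Phi>)"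
    and diffeo_inj: "inj_on \<Phi> M"
  using diffeo by (auto simp: diffeo_onto_image_def)

lemma diffeo_differentiable: "x \<in> M \<Longrightarrow> \<Phi> differentiable (at x)"
  using smooth_on_has_derivative[OF diffeo_smooth] by (auto simp: differentiable_def)

lemma diffeo_inv_differentiable: "z \<in> \<Phi> ` M \<Longrightarrow> inv_into M \<Phi> differentiable (at z)"
  using smooth_on_has_derivative[OF diffeo_inv_smooth] by (auto simp: differentiable_def)

lemma tangent_map_inv_left:
  "q \<in> M \<times> UNIV \<Longrightarrow> tangent_map (inv_into M \<Phi>) (tangent_map \<Phi> q) = q"
  by (rule tangent_map_left_inverse[OF diffeo_open])
    (auto simp: diffeo_inj diffeo_differentiable diffeo_inv_differentiable)

lemma tangent_map_inv_right:
  "r \<in> \<Phi> ` M \<times> UNIV \<Longrightarrow> tangent_map \<Phi> (tangent_map (inv_into M \<Phi>) r) = r"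
  by (rule tangent_map_left_inverse[OF diffeo_open_image])
    (auto simp: f_inv_into_f diffeo_inj diffeo_differentiable diffeo_inv_differentiable)

lemma open_transported_domain:
  assumes "open T"
  shows "open (transported_domain M \<Phi> T)"
proof -
  have "open {q \<in> M \<times> UNIV. tangent_map \<Phi> q \<in> T}"
    using smooth_on_continuous[OF smooth_on_tangent_map[OF diffeo_open diffeo_smooth]]
    by (intro continuous_open_preimage[unfolded vimage_def Int_def, simplified])
      (use assms diffeo_open in \<open>auto simp: open_Times\<close>)
  then show ?thesis by (simp add: transported_domain_def)
qed

lemma smooth_on_transported_map:
  assumes "open T" "smooth_on T D" "D ` T \<subseteq> \<Phi> ` M \<times> \<Phi> ` M"
  shows "smooth_on (transported_domain M \<Phi> T) (transported_map M \<Phi> D)"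
proof -
  note o = open_transported_domain[OF assms(1)]
  have "smooth_on (transported_domain M \<Phi> T) (tangent_map \<Phi>)"
    by (rule smooth_on_subset[OF smooth_on_tangent_map[OF diffeo_open diffeo_smooth]])
      (auto simp: transported_domain_def)
  then have "smooth_on (transported_domain M \<Phi> T) (\<lambda>q. D (tangent_map \<Phi> q))"
    by (rule smooth_on_compose[OF o assms(1) _ _ assms(2), rotated])
      (auto simp: transported_domain_def)
  then have "smooth_on (transported_domain M \<Phi> T)
      (\<lambda>q. map_prod (inv_into M \<Phi>) (inv_into M \<Phi>) (D (tangent_map \<Phi> q)))"
    using assms(3)
    by (intro smooth_on_compose[OF o open_Times[OF diffeo_open_image diffeo_open_image] _ _
          smooth_on_map_prod[OF diffeo_open_image diffeo_inv_smooth]])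
      (auto simp: transported_domain_def)
  then show ?thesis by (simp add: transported_map_eq[abs_def])
qed

text \<open>\<open>k\<close> stands for either projection. The tangent map is linear on the fibre
  over \<open>x\<close>, so the chain rule conjugates the fibre derivative by that of
  \<open>\<Phi>\<close>. Both components take the value \<open>\<Phi> x\<close> at the zero vector,
  so the same outer derivative occurs for both and their difference is conjugated as well.\<close>

lemma fibre_derivative_transport:
  assumes "x \<in> M" "(\<lambda>y. k (D (\<Phi> x, y))) differentiable (at 0)" "k (D (\<Phi> x, 0)) = \<Phi> x"
  shows "frechet_derivative (\<lambda>y. inv_into M \<Phi> (k (D (tangent_map \<Phi> (x, y))))) (at 0) v =
    frechet_derivative (inv_into M \<Phi>) (at (\<Phi> x))
      (frechet_derivative (\<lambda>y. k (D (\<Phi> x, y))) (at 0) (frechet_derivative \<Phi> (at x) v))"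
proof -
  let ?L = "frechet_derivative \<Phi> (at x)"
  have L: "(\<Phi> has_derivative ?L) (at x)"
    using diffeo_differentiable[OF assms(1)] by (simp add: frechet_derivative_works)
  have L0: "?L 0 = 0" by (rule linear_0[OF has_derivative_linear[OF L]])
  have LL: "(?L has_derivative ?L) (at 0)"
    using bounded_linear_imp_has_derivative[OF has_derivative_bounded_linear[OF L]] .
  have "((\<lambda>y. k (D (\<Phi> x, ?L y))) has_derivative
      (\<lambda>v. frechet_derivative (\<lambda>y. k (D (\<Phi> x, y))) (at 0) (?L v))) (at 0)"
    by (rule has_derivative_compose[OF LL]) (use assms(2) L0 in \<open>simp add: frechet_derivative_works\<close>)
  from has_derivative_compose[OF this, of "inv_into M \<Phi>"]
  have "((\<lambda>y. inv_into M \<Phi> (k (D (\<Phi> x, ?L y)))) has_derivative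
      (\<lambda>v. frechet_derivative (inv_into M \<Phi>) (at (\<Phi> x))
        (frechet_derivative (\<lambda>y. k (D (\<Phi> x, y))) (at 0) (?L v)))) (at 0)"
    using assms L0 diffeo_inv_differentiable[of "\<Phi> x"] by (simp add: frechet_derivative_works)
  then show ?thesis
    by (simp add: tangent_map_def frechet_derivative_at[symmetric])
qed

text \<open>The normalized difference of fibre derivatives is the identity, and a conjugate of the
  identity is the identity. The clauses on the zero section hold because the tangent map preserves
  zero vectors.\<close>

lemma discretization_map_transport:
  assumes "discretization_map (\<Phi> ` M) T D"
  shows "discretization_map M (transported_domain M \<Phi> T) (transported_map M \<Phi> D)"
proof -
  note d = assms[unfolded discretization_map_def]
  have T: "open T" and sm: "smooth_on T D" and DN: "D ` T \<subseteq> \<Phi> ` M \<times> \<Phi> ` M"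
    and zero: "\<And>z. z \<in> \<Phi> ` M \<Longrightarrow> (z, 0) \<in> T" "\<And>z. z \<in> \<Phi> ` M \<Longrightarrow> D (z, 0) = (z, z)"
    and fib: "\<And>z v. z \<in> \<Phi> ` M \<Longrightarrow> frechet_derivative (\<lambda>y. snd (D (z, y))) (at 0) v
                 - frechet_derivative (\<lambda>y. fst (D (z, y))) (at 0) v = v"
    using d by auto
  have D: "(D has_derivative frechet_derivative D (at (\<Phi> x, 0))) (at (\<Phi> x, 0))" if "x \<in> M" for x
    using smooth_on_has_derivative[OF sm] zero(1) that by auto
  have P: "((\<lambda>y. D (\<Phi> x, y)) has_derivative (\<lambda>v. frechet_derivative D (at (\<Phi> x, 0)) (0, v))) (at 0)"
    if "x \<in> M" for x
    by (rule has_derivative_compose[OF has_derivative_Pair[OF has_derivative_const has_derivative_ident] D[OF that]])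
  have dif: "(\<lambda>y. fst (D (\<Phi> x, y))) differentiable (at 0)" "(\<lambda>y. snd (D (\<Phi> x, y))) differentiable (at 0)"
    if "x \<in> M" for x
    using has_derivative_fst[OF P[OF that]] has_derivative_snd[OF P[OF that]]
    by (auto simp: differentiable_def)
  have lin: "linear (frechet_derivative (inv_into M \<Phi>) (at (\<Phi> x)))" if "x \<in> M" for x
    using diffeo_inv_differentiable that by (auto intro: linear_frechet_derivative)
  have "frechet_derivative (\<lambda>y. snd (transported_map M \<Phi> D (x, y))) (at 0) v
      - frechet_derivative (\<lambda>y. fst (transported_map M \<Phi> D (x, y))) (at 0) v = v"
    if x: "x \<in> M" for x v
  proof -
    have 1: "\<Phi> x \<in> \<Phi> ` M" using x by simp
    show ?thesis
      using fibre_derivative_transport[of x snd D v] fibre_derivative_transport[of x fst D v] x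
        zero(2)[OF 1] dif[OF x] tangent_map_inv_left[of "(x, v)"]
      by (simp add: transported_map_eq linear_diff[OF lin, symmetric] fib)
        (simp add: tangent_map_def)
  qed
  moreover have "transported_map M \<Phi> D ` transported_domain M \<Phi> T \<subseteq> M \<times> M"
    using DN inv_into_into[of _ \<Phi> M]
    by (fastforce simp: transported_domain_def transported_map_eq map_prod_def case_prod_unfold image_subset_iff mem_Times_iff)
  moreover have "(x, 0) \<in> transported_domain M \<Phi> T" "transported_map M \<Phi> D (x, 0) = (x, x)"
    if "x \<in> M" for x
    using that zero tangent_map_zero[OF diffeo_differentiable[OF that]] diffeo_inj
    by (auto simp: transported_domain_def transported_map_eq)
  ultimately show ?thesis
    using open_transported_domain[OF T] smooth_on_transported_map[OF T sm DN] diffeo_open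
    unfolding discretization_map_def by (auto simp: transported_domain_def)
qed

text \<open>The inverse is explicit: \<open>\<Phi>\<close> on both factors, then the inverse of
  \<open>D\<close>, then the tangent map of the inverse of \<open>\<Phi>\<close>. Once this is seen
  to agree with \<open>inv_into\<close>, smoothness is that of a composite.\<close>

lemma local_inverse_domain_transport:
  assumes DN: "D ` T \<subseteq> \<Phi> ` M \<times> \<Phi> ` M" and TN: "T \<subseteq> \<Phi> ` M \<times> UNIV"
    and li: "local_inverse_domain (\<Phi> ` M) T D W"
  shows "local_inverse_domain M (transported_domain M \<Phi> T) (transported_map M \<Phi> D)
    (transported_domain M \<Phi> W)"
proof -
  let ?W = "transported_domain M \<Phi> W" and ?D = "transported_map M \<Phi> D"
  let ?inv = "\<lambda>p. tangent_map (inv_into M \<Phi>) (inv_into W D (map_prod \<Phi> \<Phi> p))"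
  have WT: "W \<subseteq> T" and zero: "\<And>z. z \<in> \<Phi> ` M \<Longrightarrow> (z, 0) \<in> W" and W: "open W" and sm: "smooth_on W D"
    and inj: "inj_on D W" and oDW: "open (D ` W)" and smi: "smooth_on (D ` W) (inv_into W D)"
    using li by (auto simp: local_inverse_domain_def diffeo_onto_image_def)
  have DW: "D ` W \<subseteq> \<Phi> ` M \<times> \<Phi> ` M" and WN: "W \<subseteq> \<Phi> ` M \<times> UNIV" using WT DN TN by auto
  have Phi_D: "map_prod \<Phi> \<Phi> (?D q) = D (tangent_map \<Phi> q)" if "q \<in> ?W" for q
  proof -
    have "D (tangent_map \<Phi> q) \<in> \<Phi> ` M \<times> \<Phi> ` M"
      using that DW by (auto simp: transported_domain_def)
    then show ?thesis
      by (cases "D (tangent_map \<Phi> q)") (auto simp: transported_map_eq f_inv_into_f diffeo_inj)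
  qed
  have inv_D: "?inv (?D q) = q" if "q \<in> ?W" for q
    using that Phi_D[OF that] inv_into_f_f[OF inj] tangent_map_inv_left
    by (auto simp: transported_domain_def)
  have inj': "inj_on ?D ?W" using inv_D by (rule inj_on_inverseI)
  have inv_eq: "inv_into ?W ?D p = ?inv p" if "p \<in> ?D ` ?W" for p
    using that inv_D inv_into_f_f[OF inj'] by auto
  have inv_W: "?inv p \<in> ?W" "?D (?inv p) = p" if "p \<in> M \<times> M" "map_prod \<Phi> \<Phi> p \<in> D ` W" for p
  proof -
    let ?r = "inv_into W D (map_prod \<Phi> \<Phi> p)"
    have r: "?r \<in> W" "D ?r = map_prod \<Phi> \<Phi> p" using that(2) inv_into_into f_inv_into_f by metis+
    have t: "tangent_map \<Phi> (?inv p) = ?r" using r(1) WN by (intro tangent_map_inv_right) auto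
    have "fst ?r \<in> \<Phi> ` M" using r(1) WN by auto
    then have "fst (?inv p) \<in> M" using inv_into_into[of _ \<Phi> M] by (simp add: tangent_map_def case_prod_unfold)
    then show "?inv p \<in> ?W" using t r(1) by (simp add: transported_domain_def mem_Times_iff)
    show "?D (?inv p) = p"
      using t r(2) that(1) diffeo_inj by (auto simp: transported_map_eq)
  qed
  \<comment> \<open>As a preimage of an open set under the continuous map
    \<open>map_prod \<Phi> \<Phi>\<close>, the image is open.\<close>
  have image: "?D ` ?W = {p \<in> M \<times> M. map_prod \<Phi> \<Phi> p \<in> D ` W}"
  proof (intro equalityI subsetI)
    fix p assume "p \<in> ?D ` ?W"
    then obtain q where q: "q \<in> ?W" "p = ?D q" by auto
    then have "D (tangent_map \<Phi> q) \<in> D ` W" by (auto simp: transported_domain_def)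
    moreover from this have "D (tangent_map \<Phi> q) \<in> \<Phi> ` M \<times> \<Phi> ` M" using DW by auto
    then have "p \<in> M \<times> M"
      unfolding q(2) transported_map_eq using inv_into_into[of _ \<Phi> M]
      by (simp add: map_prod_def case_prod_unfold mem_Times_iff)
    ultimately show "p \<in> {p \<in> M \<times> M. map_prod \<Phi> \<Phi> p \<in> D ` W}"
      using Phi_D[OF q(1)] q(2) by simp
  next
    fix p assume "p \<in> {p \<in> M \<times> M. map_prod \<Phi> \<Phi> p \<in> D ` W}"
    then show "p \<in> ?D ` ?W" using inv_W[of p] by (metis (no_types, lifting) imageI mem_Collect_eq)
  qed
  note smP = smooth_on_map_prod[OF diffeo_open diffeo_smooth]
  have o: "open (?D ` ?W)"
    unfolding image
    by (intro continuous_open_preimage[unfolded vimage_def Int_def, simplified])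
      (use smooth_on_continuous[OF smP] oDW diffeo_open in \<open>auto simp: open_Times\<close>)
  have "smooth_on (?D ` ?W) (map_prod \<Phi> \<Phi>)"
    by (rule smooth_on_subset[OF smP]) (auto simp: image)
  then have "smooth_on (?D ` ?W) (\<lambda>p. inv_into W D (map_prod \<Phi> \<Phi> p))"
    by (rule smooth_on_compose[OF o oDW _ _ smi, rotated]) (auto simp: image)
  moreover have "(\<lambda>p. inv_into W D (map_prod \<Phi> \<Phi> p)) ` ?D ` ?W \<subseteq> \<Phi> ` M \<times> UNIV"
  proof -
    have "inv_into W D (map_prod \<Phi> \<Phi> p) \<in> \<Phi> ` M \<times> UNIV" if "p \<in> ?D ` ?W" for p
      using that WN by (auto simp: image dest!: inv_into_into)
    then show ?thesis by blast
  qed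
  ultimately have "smooth_on (?D ` ?W) ?inv"
    by (rule smooth_on_compose[OF o open_Times[OF diffeo_open_image open_UNIV] _ _
          smooth_on_tangent_map[OF diffeo_open_image diffeo_inv_smooth], rotated])
  then have "smooth_on (?D ` ?W) (inv_into ?W ?D)"
    by (rule iffD2[OF smooth_on_cong[OF o], rotated]) (rule inv_eq)
  moreover have "?W \<subseteq> transported_domain M \<Phi> T" using WT by (auto simp: transported_domain_def)
  moreover have "(x, 0) \<in> ?W" if "x \<in> M" for x
    using that zero tangent_map_zero[OF diffeo_differentiable[OF that]]
    by (auto simp: transported_domain_def)
  ultimately show ?thesis
    using open_transported_domain[OF W] smooth_on_transported_map[OF W sm DW] inj' o
    by (simp add: local_inverse_domain_def diffeo_onto_image_def)
qed

end

section \<open>Compactness estimates\<close>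

text \<open>Adding a closed ball of half the available radius keeps the set compact. Later mean
  value arguments run on balls centred in \<open>K\<close>, which are convex even if
  \<open>K\<close> is not, with constants taken on \<open>K'\<close>.\<close>

lemma compact_enlarge:
  fixes K :: "'a::euclidean_space set"
  assumes "compact K" "open S" "K \<subseteq> S"
  obtains \<rho> K' where "0 < \<rho>" "compact K'" "K' \<subseteq> S" "\<And>a. a \<in> K \<Longrightarrow> cball a \<rho> \<subseteq> K'"
proof -
  obtain e where e: "e > 0" "(\<Union>x\<in>K. ball x e) \<subseteq> S"
    using compact_subset_open_imp_ball_epsilon_subset[OF assms] .
  define K' where "K' = {a + b |a b. a \<in> K \<and> b \<in> cball 0 (e/2)}"
  have "compact K'" unfolding K'_def by (rule compact_sums[OF assms(1) compact_cball])
  moreover have "K' \<subseteq> S"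
  proof
    fix y assume "y \<in> K'"
    then obtain a b where "y = a + b" "a \<in> K" "norm b \<le> e/2" by (auto simp: K'_def)
    then have "y \<in> ball a e" using e(1) by (simp add: dist_norm)
    then show "y \<in> S" using e(2) \<open>a \<in> K\<close> by blast
  qed
  moreover have "cball a (e/2) \<subseteq> K'" if "a \<in> K" for a
  proof
    fix y assume "y \<in> cball a (e/2)"
    then have "y = a + (y - a)" "norm (y - a) \<le> e/2" by (auto simp: dist_norm norm_minus_commute)
    then show "y \<in> K'" unfolding K'_def mem_Collect_eq using that by (metis mem_cball_0)
  qed
  ultimately show thesis using that[of "e/2" K'] e(1) by simp
qed

text \<open>Without convexity of \<open>K\<close> the mean value inequality bounds \<open>f\<close>
  only on small balls; compactness turns these local Lipschitz bounds into a global one.\<close>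

lemma C1_lipschitz_on_compact:
  fixes f :: "'a::euclidean_space \<Rightarrow> 'b::real_normed_vector"
  assumes "open S" "Ck_on 1 S f" "compact K" "K \<subseteq> S"
  obtains L where "0 \<le> L" "\<And>x y. x \<in> K \<Longrightarrow> y \<in> K \<Longrightarrow> norm (f x - f y) \<le> L * norm (x - y)"
proof -
  let ?f' = "\<lambda>x. frechet_derivative f (at x)"
  have k: "Ck_on (Suc 0) S f" using assms(2) by simp
  have d: "(f has_derivative ?f' x) (at x)" if "x \<in> S" for x
    by (rule Ck_on_has_derivative[OF k that])
  have cont: "continuous_on (S \<times> UNIV) (\<lambda>q. ?f' (fst q) (snd q))"
    using Ck_on_derivative_pair[OF assms(1) k] by simp
  \<comment> \<open>The notion carries a time parameter; the single dummy time \<open>0\<close> is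
    used.\<close>
  have "local_lipschitz {0::real} K (\<lambda>_. f)"
  proof (rule local_lipschitzI)
    fix t :: real and x assume "x \<in> K"
    then obtain e where e: "e > 0" "cball x e \<subseteq> S"
      using assms(1,4) open_contains_cball by blast
    let ?C = "cball x e \<times> sphere (0::'a) 1"
    have cpt: "compact ((\<lambda>q. ?f' (fst q) (snd q)) ` ?C)"
      by (rule compact_continuous_image[OF continuous_on_subset[OF cont]])
        (use e in \<open>auto intro: compact_Times\<close>)
    obtain B where "\<forall>w\<in>(\<lambda>q. ?f' (fst q) (snd q)) ` ?C. norm w \<le> B"
      using compact_imp_bounded[OF cpt, unfolded bounded_iff] by (rule exE)
    then have B: "\<And>q. q \<in> ?C \<Longrightarrow> norm (?f' (fst q) (snd q)) \<le> B" by (rule bspec) (rule imageI)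
    have B': "norm (?f' y v) \<le> max B 0 * norm v" if y: "y \<in> cball x e" for y v
    proof (cases "v = 0")
      case True
      then show ?thesis using linear_0[OF has_derivative_linear[OF d]] y e(2) by (simp add: subset_iff)
    next
      case False
      interpret linear "?f' y" using has_derivative_linear[OF d] y e(2) by blast
      have "norm (?f' y ((1 / norm v) *\<^sub>R v)) \<le> B"
        using B[of "(y, (1 / norm v) *\<^sub>R v)"] y False by simp
      then have "norm (?f' y v) / norm v \<le> B" by (simp add: scale)
      then show ?thesis using False by (simp add: divide_le_eq max_mult_distrib_right max.coboundedI1)
    qed
    have "norm (f y - f z) \<le> max B 0 * norm (y - z)" if "y \<in> cball x e" "z \<in> cball x e" for y z
      by (rule differentiable_bound[OF convex_cball has_derivative_at_withinI[OF d] _ that])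
        (use e B' in \<open>auto intro!: onorm_bound\<close>)
    then have "(max B 0)-lipschitz_on (cball x e \<inter> K) f"
      by (auto intro!: lipschitz_onI simp: dist_norm)
    then show "\<exists>u>0. \<exists>L. \<forall>t\<in>cball t u \<inter> {0}. L-lipschitz_on (cball x u \<inter> K) f"
      using e(1) by blast
  qed
  from local_lipschitz_compact_implies_lipschitz[OF this assms(3)]
  obtain L where "L-lipschitz_on K f" by auto
  then show thesis
    using that[of L] lipschitz_on_nonneg lipschitz_onD by (metis dist_norm)
qed

text \<open>Apply the preceding bound to the derivative as a function of point and direction on
  \<open>K\<close> times the unit sphere, comparing pairs with equal direction, and extend by
  homogeneity.\<close>

lemma C2_derivative_lipschitz_on_compact:
  fixes f :: "'a::euclidean_space \<Rightarrow> 'b::real_normed_vector"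
  assumes "open S" "Ck_on 2 S f" "compact K" "K \<subseteq> S"
  obtains L where "0 \<le> L" "\<And>x y v. x \<in> K \<Longrightarrow> y \<in> K \<Longrightarrow>
    norm (frechet_derivative f (at x) v - frechet_derivative f (at y) v) \<le> L * norm (x - y) * norm v"
proof -
  let ?f' = "\<lambda>x. frechet_derivative f (at x)"
  have k: "Ck_on (Suc 1) S f" using assms(2) by (simp add: numeral_2_eq_2)
  have lin: "linear (?f' x)" if "x \<in> K" for x
    using Ck_on_has_derivative[OF k, of x] that assms(4) by (auto intro: has_derivative_linear)
  have "open (S \<times> (UNIV::'a set))" "compact (K \<times> sphere (0::'a) 1)" "K \<times> sphere (0::'a) 1 \<subseteq> S \<times> UNIV"
    using assms by (auto simp: open_Times compact_Times)
  from C1_lipschitz_on_compact[OF this(1) Ck_on_derivative_pair[OF assms(1) k] this(2,3)]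
  obtain L where L: "0 \<le> L" "\<And>q r. q \<in> K \<times> sphere 0 1 \<Longrightarrow> r \<in> K \<times> sphere 0 1 \<Longrightarrow>
      norm (?f' (fst q) (snd q) - ?f' (fst r) (snd r)) \<le> L * norm (q - r)" by blast
  have "norm (?f' x v - ?f' y v) \<le> L * norm (x - y) * norm v" if xy: "x \<in> K" "y \<in> K" for x y v
  proof (cases "v = 0")
    case True
    then show ?thesis using linear_0[OF lin[OF xy(1)]] linear_0[OF lin[OF xy(2)]] by simp
  next
    case False
    let ?e = "(1 / norm v) *\<^sub>R v"
    have "norm (?f' x ?e - ?f' y ?e) \<le> L * norm ((x, ?e) - (y, ?e))"
      using L(2)[of "(x, ?e)" "(y, ?e)"] xy False by simp
    also have "?f' x ?e - ?f' y ?e = (1 / norm v) *\<^sub>R (?f' x v - ?f' y v)"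
      by (simp add: linear_scale[OF lin[OF xy(1)]] linear_scale[OF lin[OF xy(2)]] scaleR_diff_right)
    finally have "norm (?f' x v - ?f' y v) / norm v \<le> L * norm (x - y)" by simp
    then show ?thesis using False by (simp add: divide_le_eq)
  qed
  then show thesis using that L(1) by blast
qed

text \<open>The bounds on \<open>v\<close> hold only in a ball, so the solution must first be
  confined to it: until it leaves, its speed is at most \<open>B\<close>, and
  \<open>h * B < \<rho>\<close> is too short a way to the boundary.\<close>

lemma exact_solution_expansion:
  fixes \<xi> :: "real \<Rightarrow> 'a::real_normed_vector"
  assumes h: "0 < h" "h * B < \<rho>" and L: "0 \<le> L"
    and d: "\<And>s. s \<in> {t..t+h} \<Longrightarrow> (\<xi> has_vector_derivative v (\<xi> s)) (at s within {t..t+h})"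
    and B: "\<And>y. norm (y - \<xi> t) \<le> \<rho> \<Longrightarrow> norm (v y) \<le> B"
    and lip: "\<And>y. norm (y - \<xi> t) \<le> \<rho> \<Longrightarrow> norm (v y - v (\<xi> t)) \<le> L * norm (y - \<xi> t)"
    and "0 < \<rho>"
  shows "norm (\<xi> (t + h) - \<xi> t - h *\<^sub>R v (\<xi> t)) \<le> L * B * h\<^sup>2"
proof -
  have B0: "0 \<le> B" using order_trans[OF norm_ge_zero B[of "\<xi> t"]] assms(7) by simp
  have cont: "continuous_on {t..t+h} \<xi>"
    unfolding continuous_on_eq_continuous_within using d has_vector_derivative_continuous by blast
  have d': "(\<xi> has_vector_derivative v (\<xi> s)) (at s)" if "t < s" "s < t + h" for s
    using d[of s] at_within_Icc_at[OF that] that by simp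
  have grow: "norm (\<xi> r - \<xi> t) \<le> B * h"
    if r: "t \<le> r" "r \<le> t + h" and in_ball: "\<And>s. t < s \<Longrightarrow> s < r \<Longrightarrow> norm (\<xi> s - \<xi> t) \<le> \<rho>" for r
  proof (cases "r = t")
    case True
    then show ?thesis using B0 h by simp
  next
    case False
    have "norm (\<xi> r - \<xi> t) \<le> B * r - B * t"
    proof (rule differentiable_bound_general[where f' = "\<lambda>s. v (\<xi> s)" and \<phi>' = "\<lambda>_. B"])
      show "continuous_on {t..r} \<xi>" using r by (auto intro: continuous_on_subset[OF cont])
      show "((*) B has_vector_derivative B) (at x)" for x
        by (auto intro!: derivative_eq_intros simp: has_real_derivative_iff_has_vector_derivative[symmetric])
    qed (use False r in_ball d' B in \<open>auto intro: continuous_on_mult_left\<close>)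
    also have "\<dots> \<le> B * h" using B0 r by (simp add: right_diff_distrib[symmetric] mult_left_mono)
    finally show ?thesis .
  qed
  have near: "norm (\<xi> s - \<xi> t) < \<rho>" if s: "s \<in> {t..t+h}" for s
  proof (rule ccontr)
    assume "\<not> norm (\<xi> s - \<xi> t) < \<rho>"
    \<comment> \<open>The times outside the open ball. Compactness provides a first one, and
      \<open>grow\<close> applies up to it.\<close>
    let ?Z = "{t..t+h} \<inter> (\<lambda>s. norm (\<xi> s - \<xi> t)) -` {\<rho>..}"
    have "closed ?Z"
      by (intro continuous_closed_preimage continuous_on_norm continuous_on_diff cont) auto
    then have "compact ({t..t+h} \<inter> ?Z)" by (rule compact_Int_closed[OF compact_Icc])
    then have "compact ?Z" by (simp only: inf.left_idem)
    moreover have "?Z \<noteq> {}" using s \<open>\<not> norm (\<xi> s - \<xi> t) < \<rho>\<close> by auto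
    ultimately obtain r where r: "r \<in> ?Z" "\<And>s. s \<in> ?Z \<Longrightarrow> r \<le> s"
      using compact_attains_inf by metis
    have "norm (\<xi> r - \<xi> t) \<le> B * h"
    proof (rule grow)
      fix s assume "t < s" "s < r"
      then show "norm (\<xi> s - \<xi> t) \<le> \<rho>" using r(1) r(2)[of s] by force
    qed (use r(1) in auto)
    then show False using r(1) h(2) by (simp add: mult.commute)
  qed
  have lin: "((\<lambda>s. s *\<^sub>R v (\<xi> t)) has_vector_derivative v (\<xi> t)) (at s)" for s
    using has_vector_derivative_scaleR[OF DERIV_ident has_vector_derivative_const] by simp
  \<comment> \<open>Subtracting the motion with constant velocity leaves the derivative
    \<open>v (\<xi> s) - v (\<xi> t)\<close>, which the Lipschitz bound and \<open>grow\<close>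
    estimate by \<open>L * B * h\<close>.\<close>
  have "norm ((\<xi> (t + h) - (t + h) *\<^sub>R v (\<xi> t)) - (\<xi> t - t *\<^sub>R v (\<xi> t)))
      \<le> (L * B * h) * (t + h) - (L * B * h) * t"
  proof (rule differentiable_bound_general[where f' = "\<lambda>s. v (\<xi> s) - v (\<xi> t)" and \<phi>' = "\<lambda>_. L * B * h"])
    show "continuous_on {t..t + h} (\<lambda>s. \<xi> s - s *\<^sub>R v (\<xi> t))"
      by (intro continuous_intros cont)
    show "continuous_on {t..t + h} ((*) (L * B * h))" by (intro continuous_intros)
    fix s assume s: "t < s" "s < t + h"
    show "((\<lambda>s. \<xi> s - s *\<^sub>R v (\<xi> t)) has_vector_derivative v (\<xi> s) - v (\<xi> t)) (at s)"
      by (rule has_vector_derivative_diff[OF d'[OF s] lin])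
    show "((*) (L * B * h) has_vector_derivative L * B * h) (at s)"
      by (auto intro!: derivative_eq_intros simp: has_real_derivative_iff_has_vector_derivative[symmetric])
    have "norm (\<xi> s - \<xi> t) \<le> B * h"
      by (rule grow) (use s near in \<open>auto intro: less_imp_le\<close>)
    then show "norm (v (\<xi> s) - v (\<xi> t)) \<le> L * B * h"
      using lip[of "\<xi> s"] near[of s] s L mult_left_mono[of "norm (\<xi> s - \<xi> t)" "B * h" L]
      by (simp add: mult.assoc)
  qed (use h in auto)
  then show ?thesis by (simp add: algebra_simps power2_eq_square)
qed

section \<open>The implicit scheme of a discretization map\<close>

lemma norm_fst_le_norm: "norm (fst q) \<le> norm q" and norm_snd_le_norm: "norm (snd q) \<le> norm q"
  by (metis norm_fst_le prod.collapse) (metis norm_snd_le prod.collapse)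

text \<open>By injectivity any preimage in \<open>W\<close> is the value of the inverse, so a step
  becomes an equation for the node \<open>p\<close>.\<close>

lemma induced_step_iff:
  assumes "inj_on D W"
  shows "induced_step D W V h x u y \<longleftrightarrow> (\<exists>p. (p, h *\<^sub>R V p u) \<in> W \<and> D (p, h *\<^sub>R V p u) = (x, y))"
proof
  assume s: "induced_step D W V h x u y"
  let ?q = "inv_into W D (x, y)"
  have xy: "(x, y) \<in> D ` W" and q: "?q = (fst ?q, h *\<^sub>R V (fst ?q) u)"
    using s by (auto simp: induced_step_def Let_def)
  have "?q \<in> W" "D ?q = (x, y)" using inv_into_into[OF xy] f_inv_into_f[OF xy] by auto
  then show "\<exists>p. (p, h *\<^sub>R V p u) \<in> W \<and> D (p, h *\<^sub>R V p u) = (x, y)"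
    using q by metis
next
  assume "\<exists>p. (p, h *\<^sub>R V p u) \<in> W \<and> D (p, h *\<^sub>R V p u) = (x, y)"
  then obtain p where p: "(p, h *\<^sub>R V p u) \<in> W" "D (p, h *\<^sub>R V p u) = (x, y)" by blast
  have "inv_into W D (x, y) = (p, h *\<^sub>R V p u)"
    using inv_into_f_f[OF assms p(1)] p(2) by simp
  moreover have "(x, y) \<in> D ` W" using p by (metis imageI)
  ultimately show "induced_step D W V h x u y" by (simp add: induced_step_def)
qed

text \<open>Existence and order of the scheme concern a general controlled vector field; keeping
  \<open>V\<close> abstract separates them from the linearization.\<close>

locale discretized_system =
  fixes M :: "'a::euclidean_space set" and T W :: "('a \<times> 'a) set" and D :: "'a \<times> 'a \<Rightarrow> 'a \<times> 'a"
    and V :: "'a \<Rightarrow> 'u::euclidean_space \<Rightarrow> 'a"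
  assumes discretization: "discretization_map M T D"
    and local_inverse: "local_inverse_domain M T D W"
    and C1: "Ck_on 1 (M \<times> UNIV) (\<lambda>(x, u). V x u)"
begin

lemma open_M: "open M" and W_subset: "W \<subseteq> M \<times> UNIV" and zero_W: "x \<in> M \<Longrightarrow> (x, 0) \<in> W"
  and open_W: "open W" and smooth_D: "smooth_on W D" and inj_D: "inj_on D W"
  and open_DW: "open (D ` W)" and smooth_inv: "smooth_on (D ` W) (inv_into W D)"
  and D_zero: "x \<in> M \<Longrightarrow> D (x, 0) = (x, x)"
  using discretization local_inverse
  by (auto simp: discretization_map_def local_inverse_domain_def diffeo_onto_image_def)

lemma DW_subset: "D ` W \<subseteq> M \<times> M"
  using discretization local_inverse unfolding discretization_map_def local_inverse_domain_def by blast

section \<open>First-order behaviour at the zero section\<close>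

abbreviation (input) dD :: "'a \<times> 'a \<Rightarrow> 'a \<times> 'a \<Rightarrow> 'a \<times> 'a" where
  "dD q \<equiv> frechet_derivative D (at q)"

lemma D_has_derivative: "q \<in> W \<Longrightarrow> (D has_derivative dD q) (at q)"
  by (rule smooth_on_has_derivative[OF smooth_D])

lemma D_has_derivative_base:
  "(p, w) \<in> W \<Longrightarrow> ((\<lambda>y. D (y, w)) has_derivative (\<lambda>v. dD (p, w) (v, 0))) (at p)"
  by (rule has_derivative_compose[OF has_derivative_Pair[OF has_derivative_ident has_derivative_const]
        D_has_derivative])

lemma D_has_derivative_fibre:
  "(p, w) \<in> W \<Longrightarrow> ((\<lambda>y. D (p, y)) has_derivative (\<lambda>v. dD (p, w) (0, v))) (at w)"
  by (rule has_derivative_compose[OF has_derivative_Pair[OF has_derivative_const has_derivative_ident]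
        D_has_derivative])

text \<open>Differentiate \<open>D (y, 0) = (y, y)\<close> along the zero section. In particular the
  displacement \<open>fst (D (p, w)) - p\<close> has vanishing base derivative at
  \<open>w = 0\<close>.\<close>

lemma dD_zero_base:
  assumes "x \<in> M"
  shows "dD (x, 0) (v, 0) = (v, v)"
proof -
  have "((\<lambda>y. (y, y)) has_derivative (\<lambda>v. dD (x, 0) (v, 0))) (at x)"
    by (rule has_derivative_transform_within_open[OF D_has_derivative_base[OF zero_W[OF assms]] open_M assms])
      (rule D_zero)
  from has_derivative_unique[OF this has_derivative_Pair[OF has_derivative_ident has_derivative_ident]]
  show ?thesis by metis
qed

lemma dD_zero_fibre:
  assumes "x \<in> M"
  shows "snd (dD (x, 0) (0, v)) - fst (dD (x, 0) (0, v)) = v"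
proof -
  note d = D_has_derivative_fibre[OF zero_W[OF assms]]
  have "frechet_derivative (\<lambda>y. snd (D (x, y))) (at 0) v
      - frechet_derivative (\<lambda>y. fst (D (x, y))) (at 0) v = v"
    using discretization assms unfolding discretization_map_def by blast
  then show ?thesis
    unfolding frechet_derivative_at[OF has_derivative_snd[OF d], symmetric]
      frechet_derivative_at[OF has_derivative_fst[OF d], symmetric] .
qed

text \<open>Two expressions have a derivative that vanishes at \<open>w = 0\<close>:
  \<open>snd D - fst D - w\<close> in the fibre direction and \<open>fst D - p\<close> in the base
  direction. A Lipschitz bound for the derivative of \<open>D\<close> makes these derivatives
  O(|w|), and the mean value inequality yields the quadratic bound and the small Lipschitz constant
  in \<open>p\<close>.\<close>

lemma discretization_estimates:
  assumes K: "compact K" "K \<subseteq> M"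
  obtains \<rho> c where "0 < \<rho>" "0 < c"
    "\<And>p w. p \<in> K \<Longrightarrow> norm w \<le> \<rho> \<Longrightarrow> (p, w) \<in> W"
    "\<And>p w. p \<in> K \<Longrightarrow> norm w \<le> \<rho> \<Longrightarrow> norm (fst (D (p, w)) - p) \<le> c * norm w"
    "\<And>p w. p \<in> K \<Longrightarrow> norm w \<le> \<rho> \<Longrightarrow>
       norm (snd (D (p, w)) - fst (D (p, w)) - w) \<le> c * (norm w)\<^sup>2"
    "\<And>p p' w w'. p \<in> K \<Longrightarrow> p' \<in> K \<Longrightarrow> norm (p - p') \<le> \<rho> \<Longrightarrow> norm w \<le> \<rho> \<Longrightarrow> norm w' \<le> \<rho> \<Longrightarrow>
       norm ((fst (D (p, w)) - p) - (fst (D (p', w')) - p')) \<le> c * (norm w * norm (p - p') + norm (w - w'))"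
proof -
  have "compact (K \<times> {0::'a})" "K \<times> {0} \<subseteq> W" using K zero_W by (auto intro: compact_Times)
  then obtain \<rho>' K' where K': "0 < \<rho>'" "compact K'" "K' \<subseteq> W" "\<And>q. q \<in> K \<times> {0} \<Longrightarrow> cball q \<rho>' \<subseteq> K'"
    using compact_enlarge[OF _ open_W] by metis
  \<comment> \<open>Half the radius, because base point and vector may both be displaced by
    \<open>\<rho>\<close>.\<close>
  define \<rho> where "\<rho> = \<rho>' / 2"
  have rho: "0 < \<rho>" using K'(1) by (simp add: \<rho>_def)
  have in_K': "(a, b) \<in> K'" if "p \<in> K" "norm (a - p) \<le> \<rho>" "norm b \<le> \<rho>" for a b p
  proof -
    have "dist (p, 0) (a, b) = norm (a - p, b)" by (simp add: dist_norm norm_Pair norm_minus_commute)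
    also have "\<dots> \<le> norm (a - p) + norm b" by (rule norm_Pair_le)
    also have "\<dots> \<le> \<rho>'" using that by (simp add: \<rho>_def)
    finally show ?thesis using K'(4)[of "(p, 0)"] that(1) by auto
  qed
  have in_K'0: "(p, b) \<in> K'" if "p \<in> K" "norm b \<le> \<rho>" for b p
    using in_K'[of p p b] that rho by simp
  have Ck: "Ck_on k W D" for k using smooth_D by (simp add: smooth_on_def)
  obtain L0 where L0: "0 \<le> L0" "\<And>q r. q \<in> K' \<Longrightarrow> r \<in> K' \<Longrightarrow> norm (D q - D r) \<le> L0 * norm (q - r)"
    using C1_lipschitz_on_compact[OF open_W Ck K'(2,3)] by blast
  obtain L where L: "0 \<le> L" "\<And>q r v. q \<in> K' \<Longrightarrow> r \<in> K' \<Longrightarrow>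
      norm (dD q v - dD r v) \<le> L * norm (q - r) * norm v"
    using C2_derivative_lipschitz_on_compact[OF open_W Ck K'(2,3)] by blast
  \<comment> \<open>\<open>L0\<close> serves the plain Lipschitz bounds, \<open>2 * L\<close> the
    difference of two components of the derivative, and \<open>1\<close> makes the constant
    positive.\<close>
  define c where "c = L0 + 2 * L + 1"
  have c: "0 < c" "L0 \<le> c" "2 * L \<le> c" "L \<le> c" using L0(1) L(1) by (auto simp: c_def)
  have D_lip: "norm (fst (D (p, w)) - fst (D (p, w'))) \<le> L0 * norm (w - w')"
    if "p \<in> K" "norm w \<le> \<rho>" "norm w' \<le> \<rho>" for p w w'
  proof -
    have "norm (fst (D (p, w) - D (p, w'))) \<le> norm (D (p, w) - D (p, w'))" by (rule norm_fst_le_norm)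
    also have "\<dots> \<le> L0 * norm ((p, w) - (p, w'))" using that by (intro L0 in_K'0)
    finally show ?thesis by simp
  qed
  show thesis
  proof (rule that[OF rho c(1)])
    show "(p, w) \<in> W" if "p \<in> K" "norm w \<le> \<rho>" for p w using in_K'0[OF that] K'(3) by blast
    show "norm (fst (D (p, w)) - p) \<le> c * norm w" if p: "p \<in> K" "norm w \<le> \<rho>" for p w
    proof -
      have "norm (fst (D (p, w)) - p) \<le> L0 * norm w"
        using D_lip[OF p, of 0] D_zero[of p] p K(2) rho by auto
      also have "\<dots> \<le> c * norm w" using c by (simp add: mult_right_mono)
      finally show ?thesis .
    qed
    show "norm (snd (D (p, w)) - fst (D (p, w)) - w) \<le> c * (norm w)\<^sup>2"
      if p: "p \<in> K" and w: "norm w \<le> \<rho>" for p w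
    proof -
      let ?e = "\<lambda>y. snd (D (p, y)) - fst (D (p, y)) - y"
      let ?e' = "\<lambda>y v. snd (dD (p, y) (0, v)) - fst (dD (p, y) (0, v)) - v"
      have pM: "p \<in> M" using p K by auto
      have "norm (?e w - ?e 0) \<le> 2 * L * norm w * norm (w - 0)"
      proof (rule differentiable_bound[where f' = ?e' and S = "cball 0 (norm w)"])
        fix y assume "y \<in> cball (0::'a) (norm w)"
        then have y: "norm y \<le> norm w" "(p, y) \<in> K'" using in_K'0[OF p] w by auto
        then have "(p, y) \<in> W" using K'(3) by blast
        note d = D_has_derivative_fibre[OF this]
        show "(?e has_derivative ?e' y) (at y within cball 0 (norm w))"
          by (rule has_derivative_at_withinI[OF has_derivative_diff[OF has_derivative_diff[OF
                  has_derivative_snd[OF d] has_derivative_fst[OF d]] has_derivative_ident]])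
        show "onorm (?e' y) \<le> 2 * L * norm w"
        proof (rule onorm_bound)
          fix v
          let ?\<Delta> = "dD (p, y) (0, v) - dD (p, 0) (0, v)"
          have "?e' y v = snd ?\<Delta> - fst ?\<Delta>" using dD_zero_fibre[OF pM, of v] by (simp add: algebra_simps)
          then have "norm (?e' y v) \<le> norm (snd ?\<Delta>) + norm (fst ?\<Delta>)"
            using norm_triangle_ineq4 by metis
          also have "\<dots> \<le> 2 * norm ?\<Delta>" using norm_snd_le_norm[of ?\<Delta>] norm_fst_le_norm[of ?\<Delta>] by linarith
          also have "norm ?\<Delta> \<le> L * norm y * norm v"
            using L(2)[OF y(2) in_K'0[OF p, of 0], of "(0, v)"] rho by simp
          also have "L * norm y * norm v \<le> L * norm w * norm v"
            using y(1) L(1) by (intro mult_right_mono mult_left_mono) auto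
          finally show "norm (?e' y v) \<le> 2 * L * norm w * norm v" by simp
        qed (use L(1) in simp)
      qed auto
      also have "2 * L * norm w * norm (w - 0) = 2 * L * (norm w)\<^sup>2" by (simp add: power2_eq_square)
      also have "\<dots> \<le> c * (norm w)\<^sup>2" using c by (simp add: mult_right_mono)
      finally show ?thesis using D_zero[OF pM] by simp
    qed
    show "norm ((fst (D (p, w)) - p) - (fst (D (p', w')) - p')) \<le> c * (norm w * norm (p - p') + norm (w - w'))"
      if p: "p \<in> K" and p': "p' \<in> K" and pp: "norm (p - p') \<le> \<rho>" and w: "norm w \<le> \<rho>" "norm w' \<le> \<rho>"
      for p p' w w'
    proof -
      let ?r = "\<lambda>y. fst (D (y, w)) - y"
      let ?r' = "\<lambda>y v. fst (dD (y, w) (v, 0)) - v"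
      have "norm (?r p - ?r p') \<le> L * norm w * norm (p - p')"
      \<comment> \<open>Points of this convex ball may lie outside \<open>K\<close>; they stay in
        range because they are within \<open>\<rho>\<close> of \<open>p\<close>.\<close>
      proof (rule differentiable_bound[where f' = ?r' and S = "cball p (norm (p - p'))"])
        fix y assume "y \<in> cball p (norm (p - p'))"
        then have y: "norm (y - p) \<le> \<rho>" using pp by (simp add: dist_norm norm_minus_commute)
        then have yK: "(y, w) \<in> K'" "(y, 0) \<in> K'" using in_K'[OF p y] w rho by auto
        then have yW: "(y, w) \<in> W" and yM: "y \<in> M" using K'(3) W_subset by auto
        note d = D_has_derivative_base[OF yW]
        show "(?r has_derivative ?r' y) (at y within cball p (norm (p - p')))"
          by (rule has_derivative_at_withinI[OF has_derivative_diff[OF has_derivative_fst[OF d] has_derivative_ident]])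
        show "onorm (?r' y) \<le> L * norm w"
        proof (rule onorm_bound)
          fix v
          have "?r' y v = fst (dD (y, w) (v, 0) - dD (y, 0) (v, 0))" using dD_zero_base[OF yM] by simp
          then have "norm (?r' y v) \<le> norm (dD (y, w) (v, 0) - dD (y, 0) (v, 0))"
            using norm_fst_le_norm by metis
          also have "\<dots> \<le> L * norm w * norm v" using L(2)[OF yK, of "(v, 0)"] by simp
          finally show "norm (?r' y v) \<le> L * norm w * norm v" .
        qed (use L(1) in simp)
      qed (auto simp: dist_norm)
      moreover have "norm (fst (D (p', w)) - fst (D (p', w'))) \<le> L0 * norm (w - w')"
        by (rule D_lip[OF p' w])
      moreover have "(fst (D (p, w)) - p) - (fst (D (p', w')) - p')
          = (?r p - ?r p') + (fst (D (p', w)) - fst (D (p', w')))" by simp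
      ultimately have "norm ((fst (D (p, w)) - p) - (fst (D (p', w')) - p'))
          \<le> L * norm w * norm (p - p') + L0 * norm (w - w')"
        by (smt (verit) norm_triangle_ineq)
      also have "\<dots> \<le> c * (norm w * norm (p - p')) + c * norm (w - w')"
        using c by (intro add_mono) (auto simp: mult.assoc mult_right_mono)
      finally show ?thesis by (simp add: distrib_left)
    qed
  qed
qed

text \<open>A step from \<open>x\<close> under control \<open>u\<close> is parametrized by the point \<open>p\<close> at which the vector field
  is evaluated: \<open>nodes h\<close> are the pairs \<open>(p, u)\<close> for which the step is defined, and \<open>base h\<close> sends them
  to \<open>(x, u)\<close>.  Solving the implicit scheme amounts to inverting \<open>base h\<close>.\<close>

definition nodes :: "real \<Rightarrow> ('a \<times> 'u) set" where
  "nodes h = {(p, u). p \<in> M \<and> (p, h *\<^sub>R V p u) \<in> W}"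

definition base :: "real \<Rightarrow> 'a \<times> 'u \<Rightarrow> 'a \<times> 'u" where
  "base h = (\<lambda>(p, u). (fst (D (p, h *\<^sub>R V p u)), u))"

lemma continuous_V: "continuous_on (M \<times> UNIV) (\<lambda>(x, u). V x u)"
  by (rule Ck_on_continuous[OF C1])

lemma nodes_subset: "nodes h \<subseteq> M \<times> UNIV" by (auto simp: nodes_def)

lemma continuous_D_nodes: "continuous_on (nodes h) (\<lambda>(p, u). D (p, h *\<^sub>R V p u))"
proof -
  have "continuous_on (nodes h) (\<lambda>q. h *\<^sub>R (\<lambda>(x, u). V x u) q)"
    by (intro continuous_on_scaleR continuous_on_const continuous_on_subset[OF continuous_V nodes_subset])
  from continuous_on_Pair[OF continuous_on_fst[OF continuous_on_id] this]
  have "continuous_on (nodes h) (\<lambda>(p, u). (p, h *\<^sub>R V p u))" by (simp add: case_prod_unfold)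
  from continuous_on_compose2[OF smooth_on_continuous[OF smooth_D] this]
  show ?thesis by (auto simp: nodes_def case_prod_unfold)
qed

lemma continuous_base: "continuous_on (nodes h) (base h)"
  using continuous_on_Pair[OF continuous_on_fst[OF continuous_D_nodes, of h] continuous_on_snd[OF continuous_on_id]]
  by (simp add: base_def case_prod_unfold)

lemma base_image_subset: "base h ` nodes h \<subseteq> M \<times> UNIV"
  using DW_subset by (force simp: base_def nodes_def)

section \<open>Estimates uniform for states and controls in a compact set\<close>

lemma V_bounds:
  assumes C: "compact C" "C \<subseteq> M \<times> UNIV"
  obtains B L where "0 < B" "0 \<le> L" "\<And>p u. (p, u) \<in> C \<Longrightarrow> norm (V p u) \<le> B"
    "\<And>p q u. (p, u) \<in> C \<Longrightarrow> (q, u) \<in> C \<Longrightarrow> norm (V p u - V q u) \<le> L * norm (p - q)"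
proof -
  have "compact ((\<lambda>(x, u). V x u) ` C)"
    by (rule compact_continuous_image[OF continuous_on_subset[OF continuous_V C(2)] C(1)])
  then obtain B where "0 < B" "\<forall>y \<in> (\<lambda>(x, u). V x u) ` C. norm y \<le> B"
    using compact_imp_bounded bounded_pos by metis
  moreover obtain L where L: "0 \<le> L" "\<And>q r. q \<in> C \<Longrightarrow> r \<in> C \<Longrightarrow>
      norm ((\<lambda>(x, u). V x u) q - (\<lambda>(x, u). V x u) r) \<le> L * norm (q - r)"
    using C1_lipschitz_on_compact[OF open_Times[OF open_M open_UNIV] C1 C] by blast
  moreover have "norm (V p u - V q u) \<le> L * norm (p - q)" if "(p, u) \<in> C" "(q, u) \<in> C" for p q u
    using L(2)[OF that] by simp
  ultimately show thesis using that[of B L] by fastforce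
qed

text \<open>Injectivity holds on all of \<open>C\<close>, not just locally. Nodes with the same base
  point are both close to it, hence within \<open>\<rho>\<close> of each other, and then the
  displacement has Lipschitz constant below 1, which leaves no room for two nodes.\<close>

lemma base_estimates:
  assumes C: "compact C" "C \<subseteq> M \<times> UNIV"
  obtains h0 c where "0 < h0" "0 < c"
    "\<And>h. 0 < h \<Longrightarrow> h < h0 \<Longrightarrow> C \<subseteq> nodes h \<and> inj_on (base h) C"
    "\<And>h p u. 0 < h \<Longrightarrow> h < h0 \<Longrightarrow> (p, u) \<in> C \<Longrightarrow> norm (fst (D (p, h *\<^sub>R V p u)) - p) \<le> c * h"
    "\<And>h p u. 0 < h \<Longrightarrow> h < h0 \<Longrightarrow> (p, u) \<in> C \<Longrightarrow>
      norm (snd (D (p, h *\<^sub>R V p u)) - fst (D (p, h *\<^sub>R V p u)) - h *\<^sub>R V p u) \<le> c * h\<^sup>2"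
proof -
  have "compact (fst ` C)" by (rule compact_continuous_image[OF continuous_on_fst[OF continuous_on_id] C(1)])
  moreover have "fst ` C \<subseteq> M" using C(2) by auto
  ultimately obtain \<rho> c where rho: "0 < \<rho>" and c: "0 < c"
    and W: "\<And>p w. p \<in> fst ` C \<Longrightarrow> norm w \<le> \<rho> \<Longrightarrow> (p, w) \<in> W"
    and e1: "\<And>p w. p \<in> fst ` C \<Longrightarrow> norm w \<le> \<rho> \<Longrightarrow> norm (fst (D (p, w)) - p) \<le> c * norm w"
    and e2: "\<And>p w. p \<in> fst ` C \<Longrightarrow> norm w \<le> \<rho> \<Longrightarrow>
       norm (snd (D (p, w)) - fst (D (p, w)) - w) \<le> c * (norm w)\<^sup>2"
    and e3: "\<And>p p' w w'. p \<in> fst ` C \<Longrightarrow> p' \<in> fst ` C \<Longrightarrow> norm (p - p') \<le> \<rho> \<Longrightarrow>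
       norm w \<le> \<rho> \<Longrightarrow> norm w' \<le> \<rho> \<Longrightarrow>
       norm ((fst (D (p, w)) - p) - (fst (D (p', w')) - p')) \<le> c * (norm w * norm (p - p') + norm (w - w'))"
    by (rule discretization_estimates) (rule that)
  obtain B L where B: "0 < B" and L: "0 \<le> L" and VB: "\<And>p u. (p, u) \<in> C \<Longrightarrow> norm (V p u) \<le> B"
    and VL: "\<And>p q u. (p, u) \<in> C \<Longrightarrow> (q, u) \<in> C \<Longrightarrow> norm (V p u - V q u) \<le> L * norm (p - q)"
    using V_bounds[OF C] by metis
  \<comment> \<open>The three terms keep \<open>h *\<^sub>R V p u\<close> in the range of the
    estimates, place nodes over one point within \<open>\<rho>\<close>, and make the displacement a
    contraction in the node.\<close>
  define h0 where "h0 = min (\<rho> / B) (min (\<rho> / (2 * c * B)) (1 / (c * (B + L))))"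
  have cBL: "0 < c * (B + L)" using B L c by simp
  have h0: "0 < h0" using rho B c cBL by (simp add: h0_def)
  have hB: "h * B < \<rho>" and hcB: "2 * c * (h * B) < \<rho>" and hBL: "h * (c * (B + L)) < 1"
    if "0 < h" "h < h0" for h
    using that B c cBL by (auto simp: h0_def less_divide_eq mult_ac)
  have w: "norm (h *\<^sub>R V p u) \<le> h * B" "norm (h *\<^sub>R V p u) \<le> \<rho>"
    if "0 < h" "h < h0" "(p, u) \<in> C" for h p u
  proof -
    show 1: "norm (h *\<^sub>R V p u) \<le> h * B" using VB[OF that(3)] that(1) by (simp add: mult_left_mono)
    show "norm (h *\<^sub>R V p u) \<le> \<rho>" using order_trans[OF 1] hB[OF that(1,2)] by simp
  qed
  have inC: "p \<in> fst ` C" if "(p, u) \<in> C" for p u using that by force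
  have d1: "norm (fst (D (p, h *\<^sub>R V p u)) - p) \<le> c * (h * B)"
    if h: "0 < h" "h < h0" "(p, u) \<in> C" for h p u
    by (rule order_trans[OF e1[OF inC[OF h(3)] w(2)[OF h]]]) (use w(1)[OF h] c in simp)
  show thesis
  \<comment> \<open>One constant for both bounds: \<open>c * B\<close> from the displacement and
    \<open>c * B\<^sup>2\<close> from the quadratic defect.\<close>
  proof (rule that[of h0 "c * B + c * B\<^sup>2"])
    show "0 < h0" by (rule h0)
    show "0 < c * B + c * B\<^sup>2" using c B by (simp add: add_pos_pos)
    show "norm (fst (D (p, h *\<^sub>R V p u)) - p) \<le> (c * B + c * B\<^sup>2) * h"
      if h: "0 < h" "h < h0" "(p, u) \<in> C" for h p u
    proof -
      have "c * (h * B) \<le> (c * B + c * B\<^sup>2) * h" using c h(1) by (simp add: algebra_simps)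
      then show ?thesis using d1[OF h] by linarith
    qed
    show "norm (snd (D (p, h *\<^sub>R V p u)) - fst (D (p, h *\<^sub>R V p u)) - h *\<^sub>R V p u) \<le> (c * B + c * B\<^sup>2) * h\<^sup>2"
      if h: "0 < h" "h < h0" "(p, u) \<in> C" for h p u
    proof -
      have "c * (norm (h *\<^sub>R V p u))\<^sup>2 \<le> c * (h * B)\<^sup>2"
        using w(1)[OF h] c by (intro mult_left_mono power_mono) auto
      also have "\<dots> \<le> (c * B + c * B\<^sup>2) * h\<^sup>2"
        using c B by (simp add: power_mult_distrib algebra_simps)
      finally show ?thesis using e2[OF inC[OF h(3)] w(2)[OF h]] by linarith
    qed
    show "C \<subseteq> nodes h \<and> inj_on (base h) C" if h: "0 < h" "h < h0" for h
    proof
      show "C \<subseteq> nodes h"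
      proof
        fix q assume q: "q \<in> C"
        then obtain p u where pu: "q = (p, u)" "(p, u) \<in> C" by (cases q) auto
        have "(p, h *\<^sub>R V p u) \<in> W" by (rule W[OF inC[OF pu(2)] w(2)[OF h pu(2)]])
        then show "q \<in> nodes h" using pu W_subset by (auto simp: nodes_def)
      qed
      show "inj_on (base h) C"
      proof (rule inj_onI)
        fix q r assume qr: "q \<in> C" "r \<in> C" "base h q = base h r"
        obtain p u where q: "q = (p, u)" by (cases q)
        obtain p' where r: "r = (p', u)" using qr(3) q by (cases r) (auto simp: base_def)
        have C': "(p, u) \<in> C" "(p', u) \<in> C" using qr q r by auto
        let ?w = "h *\<^sub>R V p u" and ?w' = "h *\<^sub>R V p' u"
        have eq: "fst (D (p, ?w)) = fst (D (p', ?w'))" using qr(3) q r by (simp add: base_def)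
        have le: "norm (p - p') \<le> \<rho>"
        proof -
          have "p - p' = (fst (D (p', ?w')) - p') - (fst (D (p, ?w)) - p)" using eq by simp
          then have "norm (p - p') \<le> norm (fst (D (p', ?w')) - p') + norm (fst (D (p, ?w)) - p)"
            using norm_triangle_ineq4 by metis
          then show ?thesis using d1[OF h C'(1)] d1[OF h C'(2)] hcB[OF h] by linarith
        qed
        have "norm (p - p') = norm ((fst (D (p, ?w)) - p) - (fst (D (p', ?w')) - p'))"
          using eq by (simp add: norm_minus_commute)
        also have "\<dots> \<le> c * (norm ?w * norm (p - p') + norm (?w - ?w'))"
          by (rule e3[OF inC[OF C'(1)] inC[OF C'(2)] le w(2)[OF h C'(1)] w(2)[OF h C'(2)]])
        also have "?w - ?w' = h *\<^sub>R (V p u - V p' u)" by (simp add: scaleR_diff_right)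
        also have "norm (h *\<^sub>R (V p u - V p' u)) \<le> h * (L * norm (p - p'))"
          using VL[OF C'] h(1) by (simp add: mult_left_mono)
        also have "norm ?w * norm (p - p') \<le> h * B * norm (p - p')"
          using w(1)[OF h C'(1)] by (rule mult_right_mono) simp
        finally have "norm (p - p') \<le> c * (h * B * norm (p - p') + h * (L * norm (p - p')))"
          using c by simp
        also have "\<dots> = (h * (c * (B + L))) * norm (p - p')" by (simp add: algebra_simps)
        finally have "\<not> 0 < norm (p - p')"
          using hBL[OF h] mult_strict_right_mono[of "h * (c * (B + L))" 1 "norm (p - p')"] by linarith
        then show "q = r" using q r by simp
      qed
    qed
  qed
qed

text \<open>A single inverse of \<open>base h\<close> needs one domain for each \<open>h\<close>,
  whereas the admissible step sizes depend on the compact set. Collecting the members of an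
  exhaustion that are good for the given \<open>h\<close> reconciles the two; the collection may be
  empty when \<open>h\<close> is large.\<close>

lemma exhausting_nodes:
  obtains \<Omega> where "\<And>h. open (\<Omega> h)" "\<And>h. \<Omega> h \<subseteq> nodes h" "\<And>h. inj_on (base h) (\<Omega> h)"
    "\<forall>C. compact C \<and> C \<subseteq> M \<times> UNIV \<longrightarrow> (\<exists>h0>0. \<forall>h. 0 < h \<and> h < h0 \<longrightarrow> C \<subseteq> \<Omega> h)"
proof -
  have "open (M \<times> (UNIV::'u set))" using open_M by (simp add: open_Times)
  then obtain K where K: "\<And>n. compact (K n)" "\<And>n. K n \<subseteq> M \<times> (UNIV::'u set)"
    "\<And>n. K n \<subseteq> interior (K (Suc n))"
    "\<And>C. compact C \<Longrightarrow> C \<subseteq> M \<times> (UNIV::'u set) \<Longrightarrow> \<exists>N. \<forall>n\<ge>N. C \<subseteq> K n"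
    using open_Union_compact_subsets[of "M \<times> (UNIV::'u set)"] by metis
  have mono: "K m \<subseteq> K n" if "m \<le> n" for m n
    by (rule lift_Suc_mono_le[OF _ that]) (rule order_trans[OF K(3) interior_subset])
  define good where "good h n \<longleftrightarrow> K n \<subseteq> nodes h \<and> inj_on (base h) (K n)" for h n
  \<comment> \<open>The sets \<open>K n\<close> form a chain, so injectivity passes to the union.\<close>
  define \<Omega> where "\<Omega> h = (\<Union>n\<in>{n. good h n}. interior (K n))" for h
  show thesis
  proof (rule that[of \<Omega>])
    show "open (\<Omega> h)" for h by (auto simp: \<Omega>_def)
    show "\<Omega> h \<subseteq> nodes h" for h using interior_subset by (fastforce simp: \<Omega>_def good_def)
    show "inj_on (base h) (\<Omega> h)" for h
    proof (rule inj_onI)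
      fix q r assume qr: "q \<in> \<Omega> h" "r \<in> \<Omega> h" and eq: "base h q = base h r"
      obtain m n where "good h m" "good h n" "q \<in> K m" "r \<in> K n"
        using qr interior_subset by (auto simp: \<Omega>_def)
      then have "good h (max m n)" "q \<in> K (max m n)" "r \<in> K (max m n)"
        using mono[of m "max m n"] mono[of n "max m n"] by (auto simp: max_def)
      then show "q = r" using eq by (auto simp: good_def dest: inj_onD)
    qed
    have "\<exists>h0>0. \<forall>h. 0 < h \<and> h < h0 \<longrightarrow> C \<subseteq> \<Omega> h"
      if C: "compact C" "C \<subseteq> M \<times> (UNIV::'u set)" for C
    proof -
      obtain N where N: "C \<subseteq> K N" using K(4)[OF C] by blast
      \<comment> \<open>The next member is used because \<open>\<Omega> h\<close> consists of
        interiors, and \<open>K N\<close> lies in the interior of \<open>K (Suc N)\<close>.\<close>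
      obtain h0 where "0 < h0" "\<And>h. 0 < h \<Longrightarrow> h < h0 \<Longrightarrow> K (Suc N) \<subseteq> nodes h \<and> inj_on (base h) (K (Suc N))"
        by (rule base_estimates[OF K(1)[of "Suc N"] K(2)]) (rule that)
      then have "0 < h0" "\<And>h. 0 < h \<Longrightarrow> h < h0 \<Longrightarrow> good h (Suc N)" unfolding good_def by blast+
      moreover have "C \<subseteq> interior (K (Suc N))" using N K(3) by blast
      ultimately have "0 < h0 \<and> (\<forall>h. 0 < h \<and> h < h0 \<longrightarrow> C \<subseteq> \<Omega> h)"
        unfolding \<Omega>_def by blast
      then show ?thesis ..
    qed
    then show "\<forall>C. compact C \<and> C \<subseteq> M \<times> UNIV \<longrightarrow> (\<exists>h0>0. \<forall>h. 0 < h \<and> h < h0 \<longrightarrow> C \<subseteq> \<Omega> h)"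
      by blast
  qed
qed

text \<open>Uniqueness of a step is stated for end points near \<open>x\<close>, while injectivity
  concerns nodes. The inverse of \<open>D\<close> sends \<open>(x, x)\<close> to a node at
  \<open>x\<close>, and uniform continuity near a compact piece of the diagonal turns closeness of
  end points into closeness of nodes.\<close>

lemma inverse_near_diagonal:
  assumes "compact K" "K \<subseteq> M" "0 < \<rho>"
  obtains \<epsilon> where "0 < \<epsilon>"
    "\<And>x y. x \<in> K \<Longrightarrow> dist y x < \<epsilon> \<Longrightarrow> (x, y) \<in> D ` W \<Longrightarrow> dist (fst (inv_into W D (x, y))) x < \<rho>"
proof -
  let ?f = "\<lambda>q. fst (inv_into W D q)"
  have inv0: "(x, x) \<in> D ` W" "?f (x, x) = x" if "x \<in> M" for x
  proof -
    show "(x, x) \<in> D ` W" using D_zero[OF that] zero_W[OF that] by (metis imageI)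
    show "?f (x, x) = x" using inv_into_f_f[OF inj_D zero_W[OF that]] D_zero[OF that] by simp
  qed
  have "compact ((\<lambda>x. (x, x)) ` K)"
    by (rule compact_continuous_image[OF continuous_on_Pair[OF continuous_on_id continuous_on_id] assms(1)])
  moreover have "(\<lambda>x. (x, x)) ` K \<subseteq> D ` W" using inv0 assms(2) by auto
  ultimately obtain r K' where K': "0 < r" "compact K'" "K' \<subseteq> D ` W"
    "\<And>q. q \<in> (\<lambda>x. (x, x)) ` K \<Longrightarrow> cball q r \<subseteq> K'"
    by (rule compact_enlarge[OF _ open_DW]) (rule that)
  have "uniformly_continuous_on K' ?f"
    by (rule compact_uniformly_continuous[OF continuous_on_subset[OF
            continuous_on_fst[OF smooth_on_continuous[OF smooth_inv]] K'(3)] K'(2)])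
  then obtain d where d: "0 < d" "\<And>a b. a \<in> K' \<Longrightarrow> b \<in> K' \<Longrightarrow> dist b a < d \<Longrightarrow> dist (?f b) (?f a) < \<rho>"
    using assms(3) unfolding uniformly_continuous_on_def by metis
  show thesis
  proof (rule that[of "min d r"])
    show "0 < min d r" using d K' by simp
    fix x y assume xy: "x \<in> K" "dist y x < min d r" "(x, y) \<in> D ` W"
    have dxy: "dist (x, y) (x, x) = dist y x" by (simp add: dist_Pair_Pair)
    have "(x, x) \<in> K'" "(x, y) \<in> K'"
      using K'(4)[of "(x, x)"] xy dxy K'(1) by (auto simp: dist_commute subset_iff)
    then have "dist (?f (x, y)) (?f (x, x)) < \<rho>" using d(2) xy dxy by simp
    then show "dist (?f (x, y)) x < \<rho>" using inv0(2) xy(1) assms(2) by auto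
  qed
qed

text \<open>A node may lie outside the given compact set, so all bounds are taken on an enlargement
  of \<open>C\<close>. The node found lies within \<open>c * h\<close> of the state; the order
  estimate needs this rate, while membership in \<open>\<Omega> h\<close> needs only
  \<open>\<rho>\<close>.\<close>

lemma nodes_near:
  assumes exhaust: "\<forall>C. compact C \<and> C \<subseteq> M \<times> UNIV \<longrightarrow> (\<exists>h0>0. \<forall>h. 0 < h \<and> h < h0 \<longrightarrow> C \<subseteq> \<Omega> h)"
    and C: "compact C" "C \<subseteq> M \<times> UNIV"
  obtains \<rho> h0 B L c where "0 < \<rho>" "0 < h0" "0 < B" "0 \<le> L" "0 < c"
    "\<And>x u p. (x, u) \<in> C \<Longrightarrow> norm (p - x) \<le> \<rho> \<Longrightarrow> norm (V p u) \<le> B"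
    "\<And>x u p. (x, u) \<in> C \<Longrightarrow> norm (p - x) \<le> \<rho> \<Longrightarrow> norm (V p u - V x u) \<le> L * norm (p - x)"
    "\<And>h x u p. 0 < h \<Longrightarrow> h < h0 \<Longrightarrow> (x, u) \<in> C \<Longrightarrow> norm (p - x) \<le> \<rho> \<Longrightarrow> (p, u) \<in> \<Omega> h"
    "\<And>h x u. 0 < h \<Longrightarrow> h < h0 \<Longrightarrow> (x, u) \<in> C \<Longrightarrow>
      \<exists>p. norm (p - x) \<le> \<rho> \<and> norm (p - x) \<le> c * h \<and> fst (D (p, h *\<^sub>R V p u)) = x \<and>
        norm (snd (D (p, h *\<^sub>R V p u)) - x - h *\<^sub>R V p u) \<le> c * h\<^sup>2"
proof -
  have oMU: "open (M \<times> (UNIV::'u set))" using open_M by (simp add: open_Times)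
  obtain \<rho> C' where rho: "0 < \<rho>" and C': "compact C'" "C' \<subseteq> M \<times> UNIV" "\<And>q. q \<in> C \<Longrightarrow> cball q \<rho> \<subseteq> C'"
    by (rule compact_enlarge[OF C(1) oMU C(2)]) (rule that)
  have near: "(p, u) \<in> C'" if "(x, u) \<in> C" "norm (p - x) \<le> \<rho>" for x u p
  proof -
    have "(p, u) \<in> cball (x, u) \<rho>"
      using that(2) by (simp add: dist_Pair_Pair dist_norm norm_minus_commute)
    then show ?thesis using C'(3)[OF that(1)] by blast
  qed
  obtain B L where BL: "0 < B" "0 \<le> L" and VB: "\<And>p u. (p, u) \<in> C' \<Longrightarrow> norm (V p u) \<le> B"
    and VL: "\<And>p q u. (p, u) \<in> C' \<Longrightarrow> (q, u) \<in> C' \<Longrightarrow> norm (V p u - V q u) \<le> L * norm (p - q)"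
    by (rule V_bounds[OF C'(1,2)]) (rule that)
  obtain h1 c where h1: "0 < h1" and c: "0 < c"
    and nodes: "\<And>h. 0 < h \<Longrightarrow> h < h1 \<Longrightarrow> C' \<subseteq> nodes h \<and> inj_on (base h) C'"
    and e1: "\<And>h p u. 0 < h \<Longrightarrow> h < h1 \<Longrightarrow> (p, u) \<in> C' \<Longrightarrow> norm (fst (D (p, h *\<^sub>R V p u)) - p) \<le> c * h"
    and e2: "\<And>h p u. 0 < h \<Longrightarrow> h < h1 \<Longrightarrow> (p, u) \<in> C' \<Longrightarrow>
      norm (snd (D (p, h *\<^sub>R V p u)) - fst (D (p, h *\<^sub>R V p u)) - h *\<^sub>R V p u) \<le> c * h\<^sup>2"
    by (rule base_estimates[OF C'(1,2)]) (rule that)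
  obtain h2 where h2: "0 < h2" "\<And>h. 0 < h \<Longrightarrow> h < h2 \<Longrightarrow> C' \<subseteq> \<Omega> h"
    using exhaust[rule_format, OF conjI[OF C'(1,2)]] by blast
  define h0 where "h0 = min (\<rho> / c) (min h1 h2)"
  have h0: "0 < h0" using rho c h1 h2 by (simp add: h0_def)
  have small: "c * h \<le> \<rho>" "h < h1" "h < h2" if "h < h0" for h
    using that c by (auto simp: h0_def less_divide_eq mult_ac)
  show thesis
  proof (rule that[OF rho h0 BL c])
    show "norm (V p u) \<le> B" if "(x, u) \<in> C" "norm (p - x) \<le> \<rho>" for x u p
      by (rule VB[OF near[OF that]])
    show "norm (V p u - V x u) \<le> L * norm (p - x)" if "(x, u) \<in> C" "norm (p - x) \<le> \<rho>" for x u p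
      by (rule VL[OF near[OF that] near[OF that(1)]]) (use rho in simp)
    show "(p, u) \<in> \<Omega> h" if "0 < h" "h < h0" "(x, u) \<in> C" "norm (p - x) \<le> \<rho>" for h x u p
      using near[OF that(3,4)] h2(2)[OF that(1) small(3)[OF that(2)]] by blast
    fix h x u assume h: "0 < h" "h < h0" and xu: "(x, u) \<in> C"
    let ?f = "\<lambda>p. fst (D (p, h *\<^sub>R V p u))"
    have in_C': "(p, u) \<in> C'" if "p \<in> cball x (c * h)" for p
      using near[OF xu, of p] that small(1)[OF h(2)] by (simp add: dist_norm norm_minus_commute)
    have "continuous_on (cball x (c * h)) (\<lambda>p. (p, u))"
      by (rule continuous_on_Pair[OF continuous_on_id continuous_on_const])
    moreover have "(\<lambda>p. (p, u)) ` cball x (c * h) \<subseteq> nodes h"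
      using in_C' nodes[OF h(1) small(2)[OF h(2)]] by blast
    ultimately have "continuous_on (cball x (c * h)) (\<lambda>p. D (p, h *\<^sub>R V p u))"
      using continuous_on_compose2[OF continuous_D_nodes] by fastforce
    then have "continuous_on (cball x (c * h)) ?f" by (rule continuous_on_fst)
    \<comment> \<open>The displacement \<open>y - ?f y\<close> is at most \<open>c * h\<close>, so
      the map whose fixed points solve \<open>?f p = x\<close> preserves the ball.\<close>
    moreover have "x' + (y - ?f y) \<in> cball x (c * h)" if "x' \<in> {x}" "y \<in> cball x (c * h)" for x' y
      using e1[OF h(1) small(2)[OF h(2)] in_C'[OF that(2)]] that(1)
      by (simp add: dist_norm norm_minus_commute)
    ultimately obtain p where p: "p \<in> cball x (c * h)" "?f p = x"
      using brouwer_surjective_cball[of x "c * h" ?f x "{x}"] c h by auto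
    have "norm (p - x) \<le> c * h" using p(1) by (simp add: dist_norm norm_minus_commute)
    moreover have "norm (snd (D (p, h *\<^sub>R V p u)) - x - h *\<^sub>R V p u) \<le> c * h\<^sup>2"
      using e2[OF h(1) small(2)[OF h(2)] in_C'[OF p(1)]] p(2) by simp
    ultimately show "\<exists>p. norm (p - x) \<le> \<rho> \<and> norm (p - x) \<le> c * h \<and> ?f p = x \<and>
        norm (snd (D (p, h *\<^sub>R V p u)) - x - h *\<^sub>R V p u) \<le> c * h\<^sup>2"
      using p(2) small(1)[OF h(2)] by (intro exI[of _ p]) linarith
  qed
qed

text \<open>The set \<open>\<Omega> h\<close> and the values of \<open>Fb\<close> at nodes are
  exported along with the scheme, since the linearization argues on nodes and must concern this same
  \<open>Fb\<close>.\<close>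

theorem first_order_scheme:
  obtains \<Omega> E Fb where "\<And>h. open (\<Omega> h)" "\<And>h. \<Omega> h \<subseteq> nodes h" "\<And>h. inj_on (base h) (\<Omega> h)"
    "\<And>h. E h = base h ` \<Omega> h"
    "\<And>h p u. (p, u) \<in> \<Omega> h \<Longrightarrow> Fb h (fst (D (p, h *\<^sub>R V p u))) u = snd (D (p, h *\<^sub>R V p u))"
    "locally_solved M (induced_step D W V) E Fb" "scheme_of_order 1 M V Fb"
proof -
  obtain \<Omega> where O: "\<And>h. open (\<Omega> h)" "\<And>h. \<Omega> h \<subseteq> nodes h" "\<And>h. inj_on (base h) (\<Omega> h)"
    and exhaust: "\<forall>C. compact C \<and> C \<subseteq> M \<times> UNIV \<longrightarrow> (\<exists>h0>0. \<forall>h. 0 < h \<and> h < h0 \<longrightarrow> C \<subseteq> \<Omega> h)"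
    by (rule exhausting_nodes) (rule that)
  define E where "E h = base h ` \<Omega> h" for h
  define node where "node h x u = fst (inv_into (\<Omega> h) (base h) (x, u))" for h x u
  define Fb where "Fb h x u = snd (D (node h x u, h *\<^sub>R V (node h x u) u))" for h x u
  have node: "node h (fst (D (p, h *\<^sub>R V p u))) u = p" if "(p, u) \<in> \<Omega> h" for h p u
    using inv_into_f_f[OF O(3) that] by (simp add: node_def base_def)
  have Fb: "Fb h (fst (D (p, h *\<^sub>R V p u))) u = snd (D (p, h *\<^sub>R V p u))" if "(p, u) \<in> \<Omega> h" for h p u
    by (simp add: Fb_def node[OF that])
  have step: "induced_step D W V h x u (Fb h x u)" if xu: "(x, u) \<in> E h" for h x u
  proof -
    obtain p where p: "(p, u) \<in> \<Omega> h" "x = fst (D (p, h *\<^sub>R V p u))"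
      using xu by (auto simp: E_def base_def)
    have "(p, h *\<^sub>R V p u) \<in> W" using p(1) O(2) by (auto simp: nodes_def)
    then show ?thesis unfolding induced_step_iff[OF inj_D] p(2) Fb[OF p(1)] by (intro exI[of _ p]) simp
  qed
  have E: "open (E h)" "E h \<subseteq> M \<times> UNIV" for h
  proof -
    show "open (E h)" unfolding E_def
      by (rule invariance_of_domain[OF continuous_on_subset[OF continuous_base O(2)] O(1,3)])
    show "E h \<subseteq> M \<times> UNIV" unfolding E_def using base_image_subset O(2) by blast
  qed
  have solved: "locally_solved M (induced_step D W V) E Fb"
    unfolding locally_solved_def
  proof (intro conjI allI impI)
    show "open (E h)" "E h \<subseteq> M \<times> UNIV" for h by (rule E)+
    show "\<forall>(x, u)\<in>E h. induced_step D W V h x u (Fb h x u)" for h using step by auto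
    fix C assume "compact C \<and> C \<subseteq> M \<times> (UNIV::'u set)"
    then have C: "compact C" "C \<subseteq> M \<times> UNIV" by auto
    obtain \<rho> h0 B L c where rho: "0 < \<rho>" and h0: "0 < h0" and B: "0 < B" and c: "0 < c"
      and VB: "\<And>x u p. (x, u) \<in> C \<Longrightarrow> norm (p - x) \<le> \<rho> \<Longrightarrow> norm (V p u) \<le> B"
      and in_O: "\<And>h x u p. 0 < h \<Longrightarrow> h < h0 \<Longrightarrow> (x, u) \<in> C \<Longrightarrow> norm (p - x) \<le> \<rho> \<Longrightarrow> (p, u) \<in> \<Omega> h"
      and ex: "\<And>h x u. 0 < h \<Longrightarrow> h < h0 \<Longrightarrow> (x, u) \<in> C \<Longrightarrow>
        \<exists>p. norm (p - x) \<le> \<rho> \<and> norm (p - x) \<le> c * h \<and> fst (D (p, h *\<^sub>R V p u)) = x \<and>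
          norm (snd (D (p, h *\<^sub>R V p u)) - x - h *\<^sub>R V p u) \<le> c * h\<^sup>2"
      by (rule nodes_near[OF exhaust C]) (rule that)
    have "compact (fst ` C)" by (rule compact_continuous_image[OF continuous_on_fst[OF continuous_on_id] C(1)])
    moreover have "fst ` C \<subseteq> M" using C(2) by auto
    ultimately obtain \<epsilon> where eps: "0 < \<epsilon>" and near: "\<And>x y. x \<in> fst ` C \<Longrightarrow> dist y x < \<epsilon> \<Longrightarrow>
        (x, y) \<in> D ` W \<Longrightarrow> dist (fst (inv_into W D (x, y))) x < \<rho>"
      by (rule inverse_near_diagonal[OF _ _ rho]) (rule that)
    \<comment> \<open>The bound 1 lets \<open>h\<^sup>2\<close> be absorbed into \<open>h\<close>,
      so that a step moves the state by at most \<open>h * (B + c)\<close>, which is below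
      \<open>\<epsilon>\<close>.\<close>
    define h1 where "h1 = min h0 (min 1 (\<epsilon> / (B + c)))"
    have "C \<subseteq> E h \<and> (\<forall>(x, u)\<in>C. dist (Fb h x u) x < \<epsilon> \<and>
        (\<forall>y. dist y x < \<epsilon> \<and> induced_step D W V h x u y \<longrightarrow> y = Fb h x u))"
      if h: "0 < h \<and> h < h1" for h
    proof -
      have hh: "0 < h" "h < h0" "h < 1" "h * (B + c) < \<epsilon>"
        using h B c by (auto simp: h1_def less_divide_eq)
      have pt: "(x, u) \<in> E h \<and> dist (Fb h x u) x < \<epsilon> \<and>
          (\<forall>y. dist y x < \<epsilon> \<and> induced_step D W V h x u y \<longrightarrow> y = Fb h x u)" if xu: "(x, u) \<in> C" for x u
      proof (intro conjI allI impI)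
        obtain p where p: "norm (p - x) \<le> \<rho>" "fst (D (p, h *\<^sub>R V p u)) = x"
          "norm (snd (D (p, h *\<^sub>R V p u)) - x - h *\<^sub>R V p u) \<le> c * h\<^sup>2"
          using ex[OF hh(1,2) xu] by blast
        note pO = in_O[OF hh(1,2) xu p(1)]
        show "(x, u) \<in> E h" unfolding E_def using pO p(2) by (force simp: base_def)
        have Fx: "Fb h x u = snd (D (p, h *\<^sub>R V p u))" using Fb[OF pO] p(2) by simp
        have "norm (Fb h x u - x) \<le> norm (Fb h x u - x - h *\<^sub>R V p u) + norm (h *\<^sub>R V p u)"
          by (metis diff_add_cancel norm_triangle_ineq)
        also have "\<dots> \<le> c * h\<^sup>2 + h * B"
          using p(3) Fx VB[OF xu p(1)] hh(1) by (intro add_mono) (auto simp: mult_left_mono)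
        also have "\<dots> \<le> h * (B + c)"
          using hh(1,3) c mult_left_mono[of "h * h" h c] mult_left_mono[of h 1 h]
          by (simp add: power2_eq_square algebra_simps)
        also note hh(4)
        finally show "dist (Fb h x u) x < \<epsilon>" by (simp add: dist_norm)
        fix y assume y: "dist y x < \<epsilon> \<and> induced_step D W V h x u y"
        then obtain p' where p': "(p', h *\<^sub>R V p' u) \<in> W" "D (p', h *\<^sub>R V p' u) = (x, y)"
          unfolding induced_step_iff[OF inj_D] by blast
        then have "(x, y) \<in> D ` W" "inv_into W D (x, y) = (p', h *\<^sub>R V p' u)"
          using inv_into_f_f[OF inj_D p'(1)] by (metis imageI, simp)
        moreover have "x \<in> fst ` C" using xu by force
        \<comment> \<open>The node of a competing step is thus in \<open>\<Omega> h\<close>, where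
          the value of \<open>Fb\<close> is determined by the node.\<close>
        ultimately have "norm (p' - x) \<le> \<rho>" using near[of x y] y by (simp add: dist_norm)
        from Fb[OF in_O[OF hh(1,2) xu this]] show "y = Fb h x u" using p'(2) by simp
      qed
      then show ?thesis by auto
    qed
    moreover have "0 < h1" using h0 eps B c by (simp add: h1_def)
    ultimately show "\<exists>h0>0. \<exists>\<epsilon>>0. \<forall>h. 0 < h \<and> h < h0 \<longrightarrow> C \<subseteq> E h \<and>
        (\<forall>(x, u)\<in>C. dist (Fb h x u) x < \<epsilon> \<and>
          (\<forall>y. dist y x < \<epsilon> \<and> induced_step D W V h x u y \<longrightarrow> y = Fb h x u))"
      using eps by blast
  qed
  have order: "scheme_of_order 1 M V Fb"
    unfolding scheme_of_order_def
  proof (intro allI impI)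
    fix C assume "compact C \<and> C \<subseteq> M \<times> (UNIV::'u set)"
    then have C: "compact C" "C \<subseteq> M \<times> UNIV" by auto
    obtain \<rho> h0 B L c where rho: "0 < \<rho>" and h0: "0 < h0" and B: "0 < B" and L: "0 \<le> L" and c: "0 < c"
      and VB: "\<And>x u p. (x, u) \<in> C \<Longrightarrow> norm (p - x) \<le> \<rho> \<Longrightarrow> norm (V p u) \<le> B"
      and VL: "\<And>x u p. (x, u) \<in> C \<Longrightarrow> norm (p - x) \<le> \<rho> \<Longrightarrow> norm (V p u - V x u) \<le> L * norm (p - x)"
      and in_O: "\<And>h x u p. 0 < h \<Longrightarrow> h < h0 \<Longrightarrow> (x, u) \<in> C \<Longrightarrow> norm (p - x) \<le> \<rho> \<Longrightarrow> (p, u) \<in> \<Omega> h"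
      and ex: "\<And>h x u. 0 < h \<Longrightarrow> h < h0 \<Longrightarrow> (x, u) \<in> C \<Longrightarrow>
        \<exists>p. norm (p - x) \<le> \<rho> \<and> norm (p - x) \<le> c * h \<and> fst (D (p, h *\<^sub>R V p u)) = x \<and>
          norm (snd (D (p, h *\<^sub>R V p u)) - x - h *\<^sub>R V p u) \<le> c * h\<^sup>2"
      by (rule nodes_near[OF exhaust C]) (rule that)
    define h1 where "h1 = min h0 (\<rho> / B)"
    \<comment> \<open>The three contributions are the second-order term of the exact solution, the
      defect of \<open>D\<close>, and the evaluation of \<open>V\<close> at a node up to
      \<open>c * h\<close> away from the state.\<close>
    define K where "K = L * B + c + L * c"
    have bound: "norm (\<xi> (t + h) - Fb h (\<xi> t) u) / h \<le> K * h ^ 1"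
      if asm: "0 < h \<and> h < h1 \<and> (\<xi> t, u) \<in> C \<and> (\<forall>s\<in>{t..t+h}. \<xi> s \<in> M \<and>
        (\<xi> has_vector_derivative V (\<xi> s) u) (at s within {t..t+h}))" for h t u and \<xi> :: "real \<Rightarrow> 'a"
    proof -
      have h: "0 < h" "h < h0" "h * B < \<rho>" and xu: "(\<xi> t, u) \<in> C"
        using asm B by (auto simp: h1_def less_divide_eq)
      let ?x = "\<xi> t"
      have exact: "norm (\<xi> (t + h) - ?x - h *\<^sub>R V ?x u) \<le> L * B * h\<^sup>2"
      proof (rule exact_solution_expansion[where v = "\<lambda>y. V y u", OF h(1,3) L])
        show "(\<xi> has_vector_derivative V (\<xi> s) u) (at s within {t..t+h})" if "s \<in> {t..t+h}" for s
          using asm that by blast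
      qed (rule VB[OF xu] VL[OF xu] rho, assumption?)+
      obtain p where p: "norm (p - ?x) \<le> \<rho>" "norm (p - ?x) \<le> c * h" "fst (D (p, h *\<^sub>R V p u)) = ?x"
        "norm (snd (D (p, h *\<^sub>R V p u)) - ?x - h *\<^sub>R V p u) \<le> c * h\<^sup>2"
        using ex[OF h(1,2) xu] by blast
      have Fx: "Fb h ?x u = snd (D (p, h *\<^sub>R V p u))" using Fb[OF in_O[OF h(1,2) xu p(1)]] p(3) by simp
      have "norm (V p u - V ?x u) \<le> L * (c * h)"
        using VL[OF xu p(1)] mult_left_mono[OF p(2) L] by linarith
      then have "norm (h *\<^sub>R (V p u - V ?x u)) \<le> h * (L * (c * h))" using h(1) by (simp add: mult_left_mono)
      moreover have "\<xi> (t + h) - Fb h ?x u = (\<xi> (t + h) - ?x - h *\<^sub>R V ?x u)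
          - (Fb h ?x u - ?x - h *\<^sub>R V p u) - h *\<^sub>R (V p u - V ?x u)"
        by (simp add: scaleR_diff_right)
      ultimately have "norm (\<xi> (t + h) - Fb h ?x u) \<le> L * B * h\<^sup>2 + c * h\<^sup>2 + h * (L * (c * h))"
        using exact p(4) Fx norm_triangle_ineq4 by (smt (verit))
      also have "\<dots> = K * h * h" by (simp add: K_def power2_eq_square algebra_simps)
      finally show ?thesis using h(1) by (simp add: divide_le_eq)
    qed
    have "0 < h1" "0 < K" using h0 rho B c L by (simp_all add: h1_def K_def add_pos_nonneg add_nonneg_pos)
    then show "\<exists>K>0. \<exists>h0>0. \<forall>h t u \<xi>. 0 < h \<and> h < h0 \<and> (\<xi> t, u) \<in> C \<and>
        (\<forall>s\<in>{t..t+h}. \<xi> s \<in> M \<and> (\<xi> has_vector_derivative V (\<xi> s) u) (at s within {t..t+h})) \<longrightarrow>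
        norm (\<xi> (t + h) - Fb h (\<xi> t) u) / h \<le> K * h ^ 1"
      using bound by blast
  qed
  show thesis by (rule that[OF O E_def Fb solved order])
qed

end

section \<open>Linearization of the scheme\<close>

lemma bounded_bilinear_matrix_vector: "bounded_bilinear ((*v) :: real^'m^'n \<Rightarrow> real^'m \<Rightarrow> real^'n)"
  unfolding bilinear_conv_bounded_bilinear[symmetric] bilinear_def
  by (auto intro!: linearI simp: matrix_vector_mult_add_rdistrib matrix_vector_right_distrib
      scaleR_matrix_vector_assoc matrix_vector_mult_scaleR)

lemmas Ck_on_matrix_vector = Ck_on_bilinear[OF bounded_bilinear_matrix_vector]

lemma extended_system_Ck:
  fixes f :: "real^'n \<Rightarrow> real^'n" and g :: "real^'n \<Rightarrow> real^'m^'n"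
    and \<alpha> :: "(real^'n) \<times> (real^'q) \<Rightarrow> real^'m"
  assumes "open X" "Ck_on k X f" "Ck_on k X g" and M: "open M" "fst ` M \<subseteq> X"
    and "Ck_on k M \<alpha>" "Ck_on k M \<beta>" "Ck_on k M \<gamma>" "Ck_on k M \<delta>"
  shows "Ck_on k (M \<times> UNIV) (\<lambda>(\<xi>, \<mu>). extended_drift f (\<lambda>x. (*v) (g x)) \<alpha> \<gamma> \<xi>
    + extended_input (\<lambda>x. (*v) (g x)) (\<lambda>\<xi>. (*v) (\<beta> \<xi>)) (\<lambda>\<xi>. (*v) (\<delta> \<xi>)) \<xi> \<mu>)"
proof -
  let ?Q = "M \<times> (UNIV :: (real^'m) set)"
  have o: "open ?Q" using M(1) by (simp add: open_Times)
  have fst: "Ck_on k ?Q fst" and snd: "Ck_on k ?Q snd"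
    by (rule Ck_on_bounded_linear[OF bounded_linear_fst o] Ck_on_bounded_linear[OF bounded_linear_snd o])+
  have onM: "Ck_on k ?Q (\<lambda>q. r (fst q))" if "Ck_on k M r" for r :: "(real^'n) \<times> (real^'q) \<Rightarrow> 'b::real_normed_vector"
    by (rule Ck_on_compose[OF o M(1) _ fst that]) auto
  have onX: "Ck_on k ?Q (\<lambda>q. r (fst (fst q)))" if "Ck_on k X r" for r :: "real^'n \<Rightarrow> 'b::real_normed_vector"
    by (rule Ck_on_compose[OF o assms(1) _ Ck_on_fst[OF o fst] that]) (use M(2) in auto)
  have "Ck_on k ?Q (\<lambda>q. (f (fst (fst q)) + g (fst (fst q)) *v \<alpha> (fst q), \<gamma> (fst q))
      + (g (fst (fst q)) *v (\<beta> (fst q) *v snd q), \<delta> (fst q) *v snd q))"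
    by (intro Ck_on_add[OF o] Ck_on_Pair[OF o] Ck_on_matrix_vector[OF o] onX[OF assms(2)] onX[OF assms(3)]
        onM[OF assms(6)] onM[OF assms(7)] onM[OF assms(8)] onM[OF assms(9)] snd)
  then show ?thesis by (simp add: extended_drift_def extended_input_def case_prod_unfold)
qed

text \<open>\<open>H\<close> inserts the feedback at the node, while \<open>base h\<close> and
  \<open>Q\<close> replace the node by the state in the variables \<open>u\<close> and
  \<open>v\<close>. The discrete feedback is read off from \<open>base h\<close> after
  \<open>H\<close> after the inverse of \<open>Q\<close>. No smallness of \<open>h\<close> is
  available for inverting \<open>Q\<close>; the identity \<open>lin\<close> takes its place.\<close>

lemma discrete_linearization:
  fixes V :: "'a::euclidean_space \<Rightarrow> real^'m \<Rightarrow> 'a" and \<Phi> :: "'a \<Rightarrow> real^'d"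
  assumes ds: "discretized_system M T W D V"
    and diffeo: "diffeo_onto_image M \<Phi>"
    and a: "continuous_on M a" and b: "continuous_on M b" "\<And>p. p \<in> M \<Longrightarrow> invertible (b p)"
    and O: "open \<Omega>" "\<Omega> \<subseteq> discretized_system.nodes M W V h" "inj_on (discretized_system.base D V h) \<Omega>"
    and E: "E = discretized_system.base D V h ` \<Omega>"
    and Fh: "\<And>p u. (p, u) \<in> \<Omega> \<Longrightarrow> Fh (fst (D (p, h *\<^sub>R V p u))) u = snd (D (p, h *\<^sub>R V p u))"
    and lin: "\<And>p v. (p, h *\<^sub>R V p (a p + b p *v v)) \<in> W \<Longrightarrow>
      \<Phi> (snd (D (p, h *\<^sub>R V p (a p + b p *v v)))) = A *v \<Phi> (fst (D (p, h *\<^sub>R V p (a p + b p *v v)))) + B *v v"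
  obtains E' \<psi> where "discrete_linearized_by M E Fh \<Phi> E' \<psi> A B"
    "\<And>x v. (x, v) \<in> E' \<Longrightarrow> \<exists>p. (p, h *\<^sub>R V p (\<psi> x v)) \<in> W \<and>
      D (p, h *\<^sub>R V p (\<psi> x v)) = (x, Fh x (\<psi> x v)) \<and> \<psi> x v = a p + b p *v v"
proof -
  interpret discretized_system M T W D V by (rule ds)
  define H where "H = (\<lambda>(p, v). (p, a p + b p *v v))"
  have H: "H (p, v) = (p, a p + b p *v v)" for p v by (simp add: H_def)
  have "continuous_on (M \<times> UNIV) (\<lambda>q. a (fst q))" "continuous_on (M \<times> UNIV) (\<lambda>q. b (fst q))"
    by (rule continuous_on_compose2[OF a continuous_on_fst[OF continuous_on_id]]
        continuous_on_compose2[OF b(1) continuous_on_fst[OF continuous_on_id]]; auto)+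
  then have "continuous_on (M \<times> UNIV) (\<lambda>q. (fst q, a (fst q) + b (fst q) *v snd q))"
    by (intro continuous_on_Pair continuous_on_add continuous_on_fst continuous_on_snd continuous_on_id
        bounded_bilinear.continuous_on[OF bounded_bilinear_matrix_vector])
  then have contH: "continuous_on (M \<times> UNIV) H" by (simp add: H_def case_prod_unfold)
  have injH: "inj_on H (M \<times> UNIV)"
  proof (rule inj_onI)
    fix q r assume qr: "q \<in> M \<times> UNIV" "r \<in> M \<times> UNIV" "H q = H r"
    obtain p v w where "q = (p, v)" "r = (p, w)" "b p *v v = b p *v w" "p \<in> M"
      using qr by (cases q; cases r) (auto simp: H)
    then show "q = r" using inj_matrix_vector_mult[OF b(2)] by (auto dest: injD)
  qed
  define \<Omega>' where "\<Omega>' = {q \<in> M \<times> UNIV. H q \<in> \<Omega>}"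
  have \<Omega>': "open \<Omega>'" "\<Omega>' \<subseteq> M \<times> UNIV"
  proof -
    have "open (M \<times> UNIV \<inter> H -` \<Omega>)"
      by (rule continuous_open_preimage[OF contH _ O(1)]) (use open_M in \<open>simp add: open_Times\<close>)
    moreover have "M \<times> UNIV \<inter> H -` \<Omega> = \<Omega>'" by (auto simp: \<Omega>'_def)
    ultimately show "open \<Omega>'" by simp
  qed (auto simp: \<Omega>'_def)
  have imH: "H ` \<Omega>' = \<Omega>"
  proof (intro equalityI subsetI)
    fix q assume q: "q \<in> \<Omega>"
    obtain p u where pu: "q = (p, u)" by (cases q)
    have p: "p \<in> M" using q pu O(2) nodes_subset by blast
    obtain c where "b p ** c = mat 1" using b(2)[OF p] unfolding invertible_def by blast
    then have "b p *v (c *v (u - a p)) = u - a p" by (simp add: matrix_vector_mul_assoc)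
    then have Hq: "H (p, c *v (u - a p)) = q" by (simp add: H pu)
    then have "(p, c *v (u - a p)) \<in> \<Omega>'" using p q unfolding \<Omega>'_def by simp
    then show "q \<in> H ` \<Omega>'" using Hq by (metis imageI)
  qed (auto simp: \<Omega>'_def)
  have W': "(p, h *\<^sub>R V p (a p + b p *v v)) \<in> W" if "(p, v) \<in> \<Omega>'" for p v
    using that O(2) by (auto simp: \<Omega>'_def H nodes_def)
  define Q where "Q = (\<lambda>(p, v). (fst (base h (H (p, v))), v))"
  have Q: "Q (p, v) = (fst (D (p, h *\<^sub>R V p (a p + b p *v v))), v)" for p v
    by (simp add: Q_def H base_def)
  have contP: "continuous_on \<Omega> (base h)" by (rule continuous_on_subset[OF continuous_base O(2)])
  have contH': "continuous_on \<Omega>' H" by (rule continuous_on_subset[OF contH \<Omega>'(2)])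
  have "continuous_on \<Omega>' (\<lambda>q. base h (H q))"
    by (rule continuous_on_compose2[OF contP contH']) (simp add: imH)
  then have "continuous_on \<Omega>' (\<lambda>q. (fst (base h (H q)), snd q))"
    by (intro continuous_on_Pair continuous_on_fst continuous_on_snd continuous_on_id)
  then have contQ: "continuous_on \<Omega>' Q" by (simp add: Q_def case_prod_unfold)
  have D_in: "D (p, h *\<^sub>R V p (a p + b p *v v)) \<in> M \<times> M" if "(p, v) \<in> \<Omega>'" for p v
    using DW_subset W'[OF that] by blast
  \<comment> \<open>For fixed \<open>x\<close> and \<open>v\<close>, the linear form of the step determines its end point, hence the node.\<close>
  have injQ: "inj_on Q \<Omega>'"
  proof (rule inj_onI)
    fix q r assume qr: "q \<in> \<Omega>'" "r \<in> \<Omega>'" "Q q = Q r"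
    obtain p v where q: "q = (p, v)" by (cases q)
    obtain p' where r: "r = (p', v)" using qr(3) q by (cases r) (auto simp: Q)
    note q' = qr(1)[unfolded q] and r' = qr(2)[unfolded r]
    have 1: "fst (D (p, h *\<^sub>R V p (a p + b p *v v))) = fst (D (p', h *\<^sub>R V p' (a p' + b p' *v v)))"
      using qr(3) unfolding q r Q by simp
    then have "\<Phi> (snd (D (p, h *\<^sub>R V p (a p + b p *v v)))) = \<Phi> (snd (D (p', h *\<^sub>R V p' (a p' + b p' *v v))))"
      using lin[OF W'[OF q']] lin[OF W'[OF r']] by simp
    then have "snd (D (p, h *\<^sub>R V p (a p + b p *v v))) = snd (D (p', h *\<^sub>R V p' (a p' + b p' *v v)))"
      using D_in[OF q'] D_in[OF r'] diffeo_inj[OF diffeo] by (auto simp: mem_Times_iff dest: inj_onD)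
    with 1 have "D (p, h *\<^sub>R V p (a p + b p *v v)) = D (p', h *\<^sub>R V p' (a p' + b p' *v v))"
      by (rule prod_eqI)
    from inj_onD[OF inj_D this W'[OF q'] W'[OF r']] show "q = r" using q r by simp
  qed
  define E' where "E' = Q ` \<Omega>'"
  obtain kQ where kQ: "homeomorphism \<Omega>' E' Q kQ"
    unfolding E'_def by (rule invariance_of_domain_homeomorphism[OF \<Omega>'(1) contQ _ injQ]) simp
  obtain kH where kH: "homeomorphism \<Omega>' \<Omega> H kH"
    by (rule invariance_of_domain_homeomorphism[OF \<Omega>'(1) contH' _ inj_on_subset[OF injH \<Omega>'(2)]])
      (simp_all add: imH)
  obtain kP where kP: "homeomorphism \<Omega> E (base h) kP"
    unfolding E by (rule invariance_of_domain_homeomorphism[OF O(1) contP _ O(3)]) simp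
  define R where "R = base h \<circ> (H \<circ> kQ)"
  define k where "k = Q \<circ> kH \<circ> kP"
  have R: "homeomorphism E' E R k"
    unfolding R_def k_def
    by (rule homeomorphism_compose[OF homeomorphism_compose[OF homeomorphism_symD[OF kQ] kH] kP])
  define \<psi> where "\<psi> x v = snd (R (x, v))" for x v
  define \<kappa> where "\<kappa> x u = snd (k (x, u))" for x u
  have node: "\<exists>p. (p, v) \<in> \<Omega>' \<and> x = fst (D (p, h *\<^sub>R V p (a p + b p *v v))) \<and> R (x, v) = (x, a p + b p *v v)"
    if xv: "(x, v) \<in> E'" for x v
  proof -
    obtain p where p: "(p, v) \<in> \<Omega>'" "(x, v) = Q (p, v)"
      using xv unfolding E'_def Q_def by auto
    have "kQ (x, v) = (p, v)" using homeomorphism_apply1[OF kQ p(1)] p(2) by simp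
    then have "R (x, v) = base h (p, a p + b p *v v)" by (simp add: R_def H)
    then show ?thesis using p by (auto simp: Q base_def)
  qed
  have R_eq: "R (x, v) = (x, \<psi> x v)" if "(x, v) \<in> E'" for x v
    using node[OF that] by (auto simp: \<psi>_def)
  \<comment> \<open>\<open>R\<close> keeps the state component, so its inverse keeps it too and has
    the form required of \<open>\<kappa>\<close>.\<close>
  have k_eq: "k (x, u) = (x, \<kappa> x u)" if xu: "(x, u) \<in> E" for x u
  proof -
    have "k (x, u) \<in> E'" using homeomorphism_image2[OF R] xu by blast
    then have "R (k (x, u)) = (fst (k (x, u)), \<psi> (fst (k (x, u))) (snd (k (x, u))))"
      using R_eq[of "fst (k (x, u))" "snd (k (x, u))"] by simp
    moreover have "R (k (x, u)) = (x, u)" by (rule homeomorphism_apply2[OF R xu])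
    ultimately show ?thesis by (simp add: \<kappa>_def prod_eq_iff)
  qed
  have hom: "homeomorphism E' E (\<lambda>(x, v). (x, \<psi> x v)) (\<lambda>(x, u). (x, \<kappa> x u))"
    by (rule homeomorphism_cong[OF R]) (auto simp: R_eq k_eq)
  have node': "\<exists>p. (p, h *\<^sub>R V p (\<psi> x v)) \<in> W \<and>
      D (p, h *\<^sub>R V p (\<psi> x v)) = (x, Fh x (\<psi> x v)) \<and> \<psi> x v = a p + b p *v v"
    if xv: "(x, v) \<in> E'" for x v
  proof -
    obtain p where p: "(p, v) \<in> \<Omega>'" "x = fst (D (p, h *\<^sub>R V p (a p + b p *v v)))" "R (x, v) = (x, a p + b p *v v)"
      using node[OF xv] by blast
    have psi: "\<psi> x v = a p + b p *v v" using p(3) by (simp add: \<psi>_def)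
    have "(p, a p + b p *v v) \<in> \<Omega>" using p(1) by (auto simp: \<Omega>'_def H)
    from Fh[OF this] have "D (p, h *\<^sub>R V p (\<psi> x v)) = (x, Fh x (\<psi> x v))"
      using p(2) unfolding psi by (simp add: prod_eq_iff)
    then show ?thesis using W'[OF p(1)] psi by (intro exI[of _ p]) simp
  qed
  have "\<Phi> (Fh x (\<psi> x v)) = A *v \<Phi> x + B *v v" if xv: "(x, v) \<in> E'" for x v
  proof -
    obtain p where "(p, h *\<^sub>R V p (\<psi> x v)) \<in> W" "D (p, h *\<^sub>R V p (\<psi> x v)) = (x, Fh x (\<psi> x v))"
      "\<psi> x v = a p + b p *v v"
      using node'[OF xv] by blast
    then show ?thesis using lin[of p v] by simp
  qed
  moreover have "open E'" unfolding E'_def by (rule invariance_of_domain[OF contQ \<Omega>'(1) injQ])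
  moreover have "E' \<subseteq> M \<times> UNIV" using D_in by (auto simp: E'_def Q mem_Times_iff)
  ultimately have "discrete_linearized_by M E Fh \<Phi> E' \<psi> A B"
    unfolding discrete_linearized_by_def using diffeo hom by blast
  from that[OF this node'] show thesis .
qed

text \<open>The same \<open>E\<close> and \<open>Fb\<close> serve solvability, order and
  linearization, so the linearized system is the one obtained by solving the scheme. The feedback is
  stated at the node because node and state differ in general: for the midpoint rule, where
  \<open>D\<^sub>\<Phi>\<close> sends \<open>(z, w)\<close> to \<open>(z - w/2, z + w/2)\<close>,
  the node corresponds to the midpoint of the linear step.\<close>

theorem theorem3p1:
  fixes X Ox :: "(real^'n) set" and U :: "(real^'m) set" and Ow :: "(real^'q) set"
    and f :: "real^'n \<Rightarrow> real^'n" and g :: "real^'n \<Rightarrow> real^'m^'n"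
    and x0 :: "real^'n" and w0 :: "real^'q"
    and \<alpha> :: "(real^'n) \<times> (real^'q) \<Rightarrow> real^'m" and \<beta> :: "(real^'n) \<times> (real^'q) \<Rightarrow> real^'m^'m"
    and \<gamma> :: "(real^'n) \<times> (real^'q) \<Rightarrow> real^'q" and \<delta> :: "(real^'n) \<times> (real^'q) \<Rightarrow> real^'m^'q"
    and M :: "((real^'n) \<times> (real^'q)) set"
    and F :: "(real^'n) \<times> (real^'q) \<Rightarrow> (real^'n) \<times> (real^'q)"
    and G :: "(real^'n) \<times> (real^'q) \<Rightarrow> real^'m \<Rightarrow> (real^'n) \<times> (real^'q)"
    and \<Phi> :: "(real^'n) \<times> (real^'q) \<Rightarrow> real^('n + 'q)" and N :: "(real^('n + 'q)) set"
    and ahat :: "(real^'n) \<times> (real^'q) \<Rightarrow> real^'m" and bhat :: "(real^'n) \<times> (real^'q) \<Rightarrow> real^'m^'m"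
    and A :: "real^('n + 'q)^('n + 'q)" and B :: "real^'m^('n + 'q)"
    and T\<^sub>\<Phi> W\<^sub>\<Phi> :: "((real^('n + 'q)) \<times> (real^('n + 'q))) set"
    and D\<^sub>\<Phi> :: "(real^('n + 'q)) \<times> (real^('n + 'q)) \<Rightarrow> (real^('n + 'q)) \<times> (real^('n + 'q))"
    and hbar :: real
    and Ah :: "real \<Rightarrow> real^('n + 'q)^('n + 'q)" and Bh :: "real \<Rightarrow> real^'m^('n + 'q)"
    and T W :: "(((real^'n) \<times> (real^'q)) \<times> ((real^'n) \<times> (real^'q))) set"
    and D :: "((real^'n) \<times> (real^'q)) \<times> ((real^'n) \<times> (real^'q))
              \<Rightarrow> ((real^'n) \<times> (real^'q)) \<times> ((real^'n) \<times> (real^'q))"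
  assumes "open X" "X \<noteq> {}" "open U" "U \<noteq> {}"
    and "Ck_on 1 X f" "Ck_on 1 X g"
    and "\<And>x. x \<in> X \<Longrightarrow> inj (\<lambda>i. column i (g x)) \<and> independent (columns (g x))"
    and "open Ox" "x0 \<in> Ox" "Ox \<subseteq> X" "open Ow" "w0 \<in> Ow"
    and M: "M = Ox \<times> Ow"
    and "Ck_on 1 M \<alpha>" "Ck_on 1 M \<beta>" "Ck_on 1 M \<gamma>" "Ck_on 1 M \<delta>"
    and F: "F = extended_drift f (\<lambda>x. (*v) (g x)) \<alpha> \<gamma>"
    and G: "G = extended_input (\<lambda>x. (*v) (g x)) (\<lambda>\<xi>. (*v) (\<beta> \<xi>)) (\<lambda>\<xi>. (*v) (\<delta> \<xi>))"
    and "transformed_into_linear M F G \<Phi> ahat bhat A B"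
    and N: "N = \<Phi> ` M"
    and "discretization_map N T\<^sub>\<Phi> D\<^sub>\<Phi>"
    and "local_inverse_domain N T\<^sub>\<Phi> D\<^sub>\<Phi> W\<^sub>\<Phi>"
    and "0 < hbar"
    and "\<And>h z v z'. 0 < h \<Longrightarrow> h < hbar \<Longrightarrow>
           induced_step D\<^sub>\<Phi> W\<^sub>\<Phi> (\<lambda>z v. A *v z + B *v v) h z v z' \<Longrightarrow>
           z' = Ah h *v z + Bh h *v v"
    and D: "D = transported_map M \<Phi> D\<^sub>\<Phi>"
    and T: "T = transported_domain M \<Phi> T\<^sub>\<Phi>"
    and W: "W = transported_domain M \<Phi> W\<^sub>\<Phi>"
  shows "discretization_map M T D \<and> local_inverse_domain M T D W \<and>
    (\<exists>E Fb.
       locally_solved M (induced_step D W (\<lambda>\<xi> \<mu>. F \<xi> + G \<xi> \<mu>)) E Fb \<and>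
       scheme_of_order 1 M (\<lambda>\<xi> \<mu>. F \<xi> + G \<xi> \<mu>) Fb \<and>
       (\<forall>h. 0 < h \<and> h < hbar \<longrightarrow>
          discrete_feedback_linearizable M (E h) (Fb h) \<and>
          (\<exists>E' \<psi>.
             discrete_linearized_by M (E h) (Fb h) \<Phi> E' \<psi> (Ah h) (Bh h) \<and>
             (\<forall>(\<xi>, v)\<in>E'. \<forall>p. p = fst (inv_into W D (\<xi>, Fb h \<xi> (\<psi> \<xi> v))) \<longrightarrow>
                \<psi> \<xi> v = ahat p + bhat p *v v) \<and>
             ((\<forall>\<zeta>\<in>W\<^sub>\<Phi>. fst (D\<^sub>\<Phi> \<zeta>) = fst \<zeta>) \<longrightarrow>
                (\<forall>(\<xi>, v)\<in>E'. \<psi> \<xi> v = ahat \<xi> + bhat \<xi> *v v)))))"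
proof -
  let ?V = "\<lambda>\<xi> \<mu>. F \<xi> + G \<xi> \<mu>" and ?L = "\<lambda>z v. A *v z + B *v v"
  note X = assms(1) and fg = assms(5,6) and Ox = assms(8,10) and Ow = assms(11)
    and compensator = assms(14-17) and linearized = assms(20) and disc = assms(22) and inv = assms(23)
    and linear_step = assms(25)
  have diffeo: "diffeo_onto_image M \<Phi>" and Ck: "Ck_on 1 M ahat" "Ck_on 1 M bhat"
    and invertible: "\<And>\<xi>. \<xi> \<in> M \<Longrightarrow> invertible (bhat \<xi>)"
    and drift: "\<And>\<xi>. \<xi> \<in> M \<Longrightarrow> frechet_derivative \<Phi> (at \<xi>) (F \<xi> + G \<xi> (ahat \<xi>)) = A *v \<Phi> \<xi>"
    and input: "\<And>\<xi> v. \<xi> \<in> M \<Longrightarrow> frechet_derivative \<Phi> (at \<xi>) (G \<xi> (bhat \<xi> *v v)) = B *v v"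
    using linearized unfolding transformed_into_linear_def by metis+
  have DM: "discretization_map M T D"
    unfolding T D by (rule discretization_map_transport[OF diffeo disc[unfolded N]])
  have D_sub: "D\<^sub>\<Phi> ` T\<^sub>\<Phi> \<subseteq> \<Phi> ` M \<times> \<Phi> ` M" "T\<^sub>\<Phi> \<subseteq> \<Phi> ` M \<times> UNIV"
    using disc unfolding N discretization_map_def by blast+
  have LI: "local_inverse_domain M T D W"
    unfolding T D W by (rule local_inverse_domain_transport[OF diffeo D_sub inv[unfolded N]])
  have inj_D\<^sub>\<Phi>: "inj_on D\<^sub>\<Phi> W\<^sub>\<Phi>" and W\<^sub>\<Phi>_sub: "W\<^sub>\<Phi> \<subseteq> T\<^sub>\<Phi>"
    using inv by (auto simp: local_inverse_domain_def diffeo_onto_image_def)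
  have "fst ` M \<subseteq> X" using Ox(2) M by auto
  from extended_system_Ck[OF X fg diffeo_open[OF diffeo] this compensator]
  have "Ck_on 1 (M \<times> UNIV) (\<lambda>(\<xi>, \<mu>). ?V \<xi> \<mu>)" by (simp only: F G)
  then have ds: "discretized_system M T W D ?V" using DM LI by (simp add: discretized_system_def)
  interpret discretized_system M T W D ?V by (rule ds)
  obtain \<Omega> E Fb where O: "\<And>h. open (\<Omega> h)" "\<And>h. \<Omega> h \<subseteq> nodes h" "\<And>h. inj_on (base h) (\<Omega> h)"
    and E: "\<And>h. E h = base h ` \<Omega> h"
    and Fb: "\<And>h p u. (p, u) \<in> \<Omega> h \<Longrightarrow> Fb h (fst (D (p, h *\<^sub>R ?V p u))) u = snd (D (p, h *\<^sub>R ?V p u))"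
    and scheme: "locally_solved M (induced_step D W ?V) E Fb" "scheme_of_order 1 M ?V Fb"
    by (rule first_order_scheme) (rule that)
  have G_add: "G \<xi> (u + v) = G \<xi> u + G \<xi> v" for \<xi> u v
    by (simp add: G extended_input_def matrix_vector_right_distrib)
  have lin_d\<Phi>: "linear (frechet_derivative \<Phi> (at p))" if "p \<in> M" for p
    using diffeo_differentiable[OF diffeo that] by (rule linear_frechet_derivative)
  \<comment> \<open>With the feedback inserted, the field splits into
    \<open>F p + G p (ahat p)\<close> and \<open>G p (bhat p *v v)\<close>, whose images are the two
    sides of the linear system.\<close>
  have tangent: "tangent_map \<Phi> (p, h *\<^sub>R ?V p (ahat p + bhat p *v v)) = (\<Phi> p, h *\<^sub>R ?L (\<Phi> p) v)"
    if "p \<in> M" for h p v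
  proof -
    have "?V p (ahat p + bhat p *v v) = (F p + G p (ahat p)) + G p (bhat p *v v)"
      by (simp add: G_add add.assoc)
    then show ?thesis
      using drift[OF that] input[OF that]
      by (simp add: tangent_map_def linear_scale[OF lin_d\<Phi>[OF that]] linear_add[OF lin_d\<Phi>[OF that]])
  qed
  have \<Phi>_D: "D\<^sub>\<Phi> (tangent_map \<Phi> q) = (\<Phi> (fst (D q)), \<Phi> (snd (D q)))" if "q \<in> W" for q
  proof -
    have "D\<^sub>\<Phi> (tangent_map \<Phi> q) \<in> \<Phi> ` M \<times> \<Phi> ` M"
      using that W\<^sub>\<Phi>_sub D_sub by (auto simp: W transported_domain_def)
    then show ?thesis
      by (auto simp: D transported_map_eq f_inv_into_f mem_Times_iff prod_eq_iff)
  qed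
  \<comment> \<open>The node of the image step is \<open>\<Phi> p\<close>, so the assumed linear
    form applies to it.\<close>
  have lin: "\<Phi> (snd (D (p, h *\<^sub>R ?V p (ahat p + bhat p *v v)))) =
      Ah h *v \<Phi> (fst (D (p, h *\<^sub>R ?V p (ahat p + bhat p *v v)))) + Bh h *v v"
    if h: "0 < h" "h < hbar" and W': "(p, h *\<^sub>R ?V p (ahat p + bhat p *v v)) \<in> W" for h p v
  proof (rule linear_step[OF h])
    have p: "p \<in> M" using W' W_subset by auto
    have "(\<Phi> p, h *\<^sub>R ?L (\<Phi> p) v) \<in> W\<^sub>\<Phi>"
      using W' unfolding W transported_domain_def tangent[OF p, symmetric] by simp
    then show "induced_step D\<^sub>\<Phi> W\<^sub>\<Phi> ?L h (\<Phi> (fst (D (p, h *\<^sub>R ?V p (ahat p + bhat p *v v))))) v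
        (\<Phi> (snd (D (p, h *\<^sub>R ?V p (ahat p + bhat p *v v)))))"
      unfolding induced_step_iff[OF inj_D\<^sub>\<Phi>] using \<Phi>_D[OF W'] tangent[OF p]
      by (intro exI[of _ "\<Phi> p"]) simp
  qed
  have "discrete_feedback_linearizable M (E h) (Fb h) \<and>
      (\<exists>E' \<psi>. discrete_linearized_by M (E h) (Fb h) \<Phi> E' \<psi> (Ah h) (Bh h) \<and>
        (\<forall>(\<xi>, v)\<in>E'. \<forall>p. p = fst (inv_into W D (\<xi>, Fb h \<xi> (\<psi> \<xi> v))) \<longrightarrow> \<psi> \<xi> v = ahat p + bhat p *v v) \<and>
        ((\<forall>\<zeta>\<in>W\<^sub>\<Phi>. fst (D\<^sub>\<Phi> \<zeta>) = fst \<zeta>) \<longrightarrow> (\<forall>(\<xi>, v)\<in>E'. \<psi> \<xi> v = ahat \<xi> + bhat \<xi> *v v)))"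
    if h: "0 < h" "h < hbar" for h
  proof -
    obtain E' \<psi> where lby: "discrete_linearized_by M (E h) (Fb h) \<Phi> E' \<psi> (Ah h) (Bh h)"
      and node: "\<And>x v. (x, v) \<in> E' \<Longrightarrow> \<exists>p. (p, h *\<^sub>R ?V p (\<psi> x v)) \<in> W \<and>
        D (p, h *\<^sub>R ?V p (\<psi> x v)) = (x, Fb h x (\<psi> x v)) \<and> \<psi> x v = ahat p + bhat p *v v"
      by (rule discrete_linearization[OF ds diffeo Ck_on_continuous[OF Ck(1)] Ck_on_continuous[OF Ck(2)]
            invertible O E Fb lin[OF h]]) (assumption | rule that)+
    have feedback: "\<psi> x v = ahat p + bhat p *v v"
      if xv: "(x, v) \<in> E'" and p: "p = fst (inv_into W D (x, Fb h x (\<psi> x v)))" for x v p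
    proof -
      obtain p' where p': "(p', h *\<^sub>R ?V p' (\<psi> x v)) \<in> W"
        "D (p', h *\<^sub>R ?V p' (\<psi> x v)) = (x, Fb h x (\<psi> x v))" "\<psi> x v = ahat p' + bhat p' *v v"
        using node[OF xv] by blast
      \<comment> \<open>Injectivity of \<open>D\<close> on \<open>W\<close> identifies the node from
        the construction with the one given by the inverse.\<close>
      then have "p = p'" using p inv_into_f_f[OF inj_D p'(1)] by simp
      then show ?thesis using p'(3) by simp
    qed
    have feedback0: "\<psi> x v = ahat x + bhat x *v v"
      if xv: "(x, v) \<in> E'" and explicit: "\<forall>\<zeta>\<in>W\<^sub>\<Phi>. fst (D\<^sub>\<Phi> \<zeta>) = fst \<zeta>" for x v
    proof -
      obtain p where p: "(p, h *\<^sub>R ?V p (\<psi> x v)) \<in> W"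
        "D (p, h *\<^sub>R ?V p (\<psi> x v)) = (x, Fb h x (\<psi> x v))" "\<psi> x v = ahat p + bhat p *v v"
        using node[OF xv] by blast
      have pM: "p \<in> M" using p(1) W_subset by auto
      have "D (p, h *\<^sub>R ?V p (\<psi> x v)) \<in> M \<times> M" using DW_subset p(1) by blast
      then have xM: "x \<in> M" unfolding p(2) by simp
      \<comment> \<open>If the first component of \<open>D\<^sub>\<Phi>\<close> is the projection,
        state and node have the same image under \<open>\<Phi>\<close>.\<close>
      have "\<Phi> x = fst (D\<^sub>\<Phi> (tangent_map \<Phi> (p, h *\<^sub>R ?V p (\<psi> x v))))" using \<Phi>_D[OF p(1)] p(2) by simp
      also have "\<dots> = \<Phi> p"
        using explicit p(1) by (auto simp: W transported_domain_def tangent_map_def)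
      finally have "x = p" using diffeo_inj[OF diffeo] xM pM by (auto dest: inj_onD)
      then show ?thesis using p(3) by simp
    qed
    show ?thesis
      using lby feedback feedback0 unfolding discrete_feedback_linearizable_def by blast
  qed
  then show ?thesis using DM LI scheme by blast
qed

end
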